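(* Let $\mathbb{K}$ be a field. For every fixed constant $c>0$ and every fixed polynomial function $P$, there is a polynomial-time algorithm for the following problem. The input consists of two sparse polynomials $F,G\in\mathbb{K}[X]$ of degrees $m+n-1$ and $m$ respectively ($n\ge 1$) and sparsity at most $T$, where $G$ can be written as $$G=G_0+X^kG_1-X^\ell G_2,$$ with $G_0,G_1,G_2\in\mathbb{K}[X]$, $G_1\ne 0$, such that $k-\deg(G_0)\ge c\,n$ and $\ell-k-\deg(G_1)\ge c\,n$ (that is, both are $\Omega(n)$), and $\deg(G_1)\le P(T\log(m+n))$ (that is, $\deg(G_1)=(T\log(m+n))^{O(1)}$). The algorithm decides whether $G$ divides $F$.
   Context: The sparsity of a polynomial is its number of nonzero terms. Polynomials are given in sparse representation: the list of pairs (exponent, nonzero coefficient), with exponents written in binary. For $F$, $G$ of degrees $m+n-1$ and $m$ and sparsity at most $T$, the input size is $O(T\log(m+n))$, and "polynomial time" means cost $(T\log(m+n))^{O(1)}$, where one counts operations in $\mathbb{K}$ (each at unit cost) and bit operations on exponents. The degree of the zero polynomial is $-\infty$. *)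

theory Defs
  imports
    "HOL-Computational_Algebra.Polynomial"
    "HOL-Library.Extended_Real"
    "HOL-Library.Log_Nat"
begin

section \<open>Sparse polynomials\<close>

text \<open>Unlike \<^const>\<open>degree\<close>, the degree of the zero polynomial is \<open>-\<infinity>\<close> here.\<close>

definition pdeg :: "'a::zero poly \<Rightarrow> ereal" where
  "pdeg p = (if p = 0 then -\<infinity> else ereal (real (degree p)))"

definition sparsity :: "'a::zero poly \<Rightarrow> nat" where
  "sparsity p = card {e. coeff p e \<noteq> 0}"

text \<open>The terms may be listed in any order.\<close>

definition sparse_rep :: "(nat \<times> 'a::zero) list \<Rightarrow> 'a poly \<Rightarrow> bool" where
  "sparse_rep xs p \<longleftrightarrow> distinct xs \<and> set xs = {(e, coeff p e) | e. coeff p e \<noteq> 0}"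


section \<open>Programs over a field, with their cost\<close>

text \<open>
  The machine is a While language over a finite set of registers. A register holds an
  immutable value: the empty list, an element of the field, a natural number, or a cell
  with two components. Values are thought of as pointers, so copying a register,
  building a cell and selecting a component have unit cost, also when values are shared.
  An operation or a zero test in the field has unit cost. An operation on natural numbers
  costs the number of bit operations of the schoolbook algorithm on binary expansions (up to
  a constant factor). There is no conversion between numbers and field elements, and the only
  field constants are 0 and 1, so a program does not refer to a particular field.
\<close>

datatype 'a val = Null | Elt 'a | Num nat | Cell "'a val" "'a val"

text \<open>Selectors are total; a value of the wrong sort is read as a default.\<close>

fun elt_of :: "'a::zero val \<Rightarrow> 'a" where
  "elt_of (Elt a) = a"
| "elt_of _ = 0"

fun num_of :: "'a val \<Rightarrow> nat" where
  "num_of (Num i) = i"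
| "num_of _ = 0"

fun left_of :: "'a val \<Rightarrow> 'a val" where
  "left_of (Cell u v) = u"
| "left_of _ = Null"

fun right_of :: "'a val \<Rightarrow> 'a val" where
  "right_of (Cell u v) = v"
| "right_of _ = Null"

type_synonym reg = nat
type_synonym 'a store = "reg \<Rightarrow> 'a val"

datatype expr =
    Copy reg
  | ENull | ECell reg reg | ELeft reg | ERight reg
  | EZero | EOne | EAdd reg reg | ESub reg reg | EMul reg reg | EDiv reg reg
  | NConst nat | NAdd reg reg | NSub reg reg | NMul reg reg | NDiv reg reg

datatype test = IsNull reg | IsZero reg | NLess reg reg

datatype com =
    Skip
  | Assign reg expr
  | Seq com com
  | Cond test com com
  | While test com

text \<open>
  Division by zero yields 0, in the field and on numbers; subtraction of numbers is truncated.
\<close>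

fun eval :: "expr \<Rightarrow> 'a::field store \<Rightarrow> 'a val" where
  "eval (Copy x) s = s x"
| "eval ENull s = Null"
| "eval (ECell x y) s = Cell (s x) (s y)"
| "eval (ELeft x) s = left_of (s x)"
| "eval (ERight x) s = right_of (s x)"
| "eval EZero s = Elt 0"
| "eval EOne s = Elt 1"
| "eval (EAdd x y) s = Elt (elt_of (s x) + elt_of (s y))"
| "eval (ESub x y) s = Elt (elt_of (s x) - elt_of (s y))"
| "eval (EMul x y) s = Elt (elt_of (s x) * elt_of (s y))"
| "eval (EDiv x y) s = Elt (elt_of (s x) / elt_of (s y))"
| "eval (NConst i) s = Num i"
| "eval (NAdd x y) s = Num (num_of (s x) + num_of (s y))"
| "eval (NSub x y) s = Num (num_of (s x) - num_of (s y))"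
| "eval (NMul x y) s = Num (num_of (s x) * num_of (s y))"
| "eval (NDiv x y) s = Num (num_of (s x) div num_of (s y))"

text \<open>\<open>floorlog 2 i\<close> is the length of the binary expansion of \<open>i\<close>, and it is 0 for \<open>i = 0\<close>.\<close>

abbreviation bits :: "'a val \<Rightarrow> nat" where
  "bits v \<equiv> floorlog 2 (num_of v)"

fun eval_cost :: "expr \<Rightarrow> 'a::field store \<Rightarrow> nat" where
  "eval_cost (NConst i) s = 1 + floorlog 2 i"
| "eval_cost (NAdd x y) s = 1 + bits (s x) + bits (s y)"
| "eval_cost (NSub x y) s = 1 + bits (s x) + bits (s y)"
| "eval_cost (NMul x y) s = (1 + bits (s x)) * (1 + bits (s y))"
| "eval_cost (NDiv x y) s = (1 + bits (s x)) * (1 + bits (s y))"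
| "eval_cost _ s = 1"

fun holds :: "test \<Rightarrow> 'a::field store \<Rightarrow> bool" where
  "holds (IsNull x) s \<longleftrightarrow> s x = Null"
| "holds (IsZero x) s \<longleftrightarrow> elt_of (s x) = 0"
| "holds (NLess x y) s \<longleftrightarrow> num_of (s x) < num_of (s y)"

fun test_cost :: "test \<Rightarrow> 'a::field store \<Rightarrow> nat" where
  "test_cost (NLess x y) s = 1 + bits (s x) + bits (s y)"
| "test_cost _ s = 1"

text \<open>
  \<open>exec p s t s'\<close>: started in \<open>s\<close>, the program \<open>p\<close> terminates in \<open>s'\<close> with total cost \<open>t\<close>.
\<close>

inductive exec :: "com \<Rightarrow> 'a::field store \<Rightarrow> nat \<Rightarrow> 'a store \<Rightarrow> bool" where
  Skip: "exec Skip s 1 s"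
| Assign: "exec (Assign x a) s (eval_cost a s) (s(x := eval a s))"
| Seq: "exec p s t s' \<Longrightarrow> exec q s' t' s'' \<Longrightarrow> exec (Seq p q) s (t + t') s''"
| CondTrue: "holds b s \<Longrightarrow> exec p s t s' \<Longrightarrow> exec (Cond b p q) s (test_cost b s + t) s'"
| CondFalse: "\<not> holds b s \<Longrightarrow> exec q s t s' \<Longrightarrow> exec (Cond b p q) s (test_cost b s + t) s'"
| WhileFalse: "\<not> holds b s \<Longrightarrow> exec (While b p) s (test_cost b s) s"
| WhileTrue: "holds b s \<Longrightarrow> exec p s t s' \<Longrightarrow> exec (While b p) s' t' s'' \<Longrightarrow>
    exec (While b p) s (test_cost b s + t + t') s''"

inductive_cases exec_SkipE: "exec Skip s t s'"
inductive_cases exec_AssignE: "exec (Assign x a) s t s'"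
inductive_cases exec_SeqE: "exec (Seq p q) s t s'"
inductive_cases exec_CondE: "exec (Cond b p q) s t s'"
inductive_cases exec_WhileE: "exec (While b p) s t s'"

lemma exec_deterministic:
  "exec p s t s' \<Longrightarrow> exec p s u s'' \<Longrightarrow> u = t \<and> s'' = s'"
proof (induction arbitrary: u s'' rule: exec.induct)
  case (Skip s)
  from Skip.prems show ?case by (rule exec_SkipE) simp
next
  case (Assign x a s)
  from Assign.prems show ?case by (rule exec_AssignE) simp
next
  case (Seq p s t s' q t' r)
  from Seq.prems obtain v w s1 where
    "exec p s v s1" "exec q s1 w s''" "u = v + w"
    by (rule exec_SeqE)
  with Seq.IH(1)[of v s1] Seq.IH(2)[of w s''] show ?case by simp
next
  case (CondTrue b s p t s' q)
  from CondTrue.prems obtain v where "exec p s v s''" "u = test_cost b s + v"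
    using CondTrue.hyps(1) by - (erule exec_CondE, auto)
  with CondTrue.IH[of v s''] show ?case by simp
next
  case (CondFalse b s q t s' p)
  from CondFalse.prems obtain v where "exec q s v s''" "u = test_cost b s + v"
    using CondFalse.hyps(1) by - (erule exec_CondE, auto)
  with CondFalse.IH[of v s''] show ?case by simp
next
  case (WhileFalse b s p)
  from WhileFalse.prems show ?case
    using WhileFalse.hyps by - (erule exec_WhileE, auto)
next
  case (WhileTrue b s p t s' t' r)
  from WhileTrue.prems obtain v w s1 where
    "exec p s v s1" "exec (While b p) s1 w s''" "u = test_cost b s + v + w"
    using WhileTrue.hyps(1) by - (erule exec_WhileE, auto)
  with WhileTrue.IH(1)[of v s1] WhileTrue.IH(2)[of w s''] show ?case by simp
qed

fun encode :: "(nat \<times> 'a) list \<Rightarrow> 'a val" where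
  "encode [] = Null"
| "encode ((e, a) # xs) = Cell (Cell (Num e) (Elt a)) (encode xs)"

definition input :: "(nat \<times> 'a) list \<Rightarrow> (nat \<times> 'a) list \<Rightarrow> 'a store" where
  "input fs gs = (\<lambda>_. Null)(0 := encode fs, 1 := encode gs)"

text \<open>The answer is read from register 0.\<close>

definition answers :: "com \<Rightarrow> 'a::field store \<Rightarrow> bool \<Rightarrow> real \<Rightarrow> bool" where
  "answers p s r B \<longleftrightarrow>
    (\<exists>t s'. exec p s t s' \<and> real t \<le> B \<and> s' 0 = Num (if r then 1 else 0))"

end

theory Submission
  imports Defs
begin

text \<open>
  Write \<open>G = U + V - W\<close> with \<open>V = X ^ i G\<^sub>1\<close> the middle part, and let \<open>d\<close> be the degree of
  \<open>G\<^sub>1\<close> and \<open>q \<ge> 1 / c\<close>. The decomposition is not part of the input; among all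
  pairs of exponents of \<open>G\<close> that delimit a part with gaps of at least \<open>n / q\<close> on both sides,
  one with \<open>d\<close> minimal is taken. If \<open>n < 8 q ^ 3 d\<close>, then \<open>n\<close> is polynomially small and long
  division is affordable.

  Otherwise put \<open>r = 2 q\<close>. The polynomial \<open>(V ^ r - W ^ r) ^ r - (V ^ r - (U + V) ^ r) ^ r\<close> is a
  multiple \<open>R G\<close> of \<open>G\<close> with only polynomially many terms, and its part \<open>V ^ (r ^ 2)\<close> is separated
  from the rest by gaps of length at least \<open>n\<close>. So if \<open>F = G Q\<close>, then
  \<open>G\<^sub>1 ^ (r ^ 2) Q\<close> can be read off as a window \<open>N\<close> of \<open>R F\<close>. Conversely
  \<open>G\<close> divides \<open>F\<close> as soon as \<open>G N = F D\<close> and \<open>D\<close> divides \<open>N\<close>, where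
  \<open>D = G\<^sub>1 ^ (r ^ 2)\<close>. The first condition is an identity of sparse polynomials; the second is checked
  by reducing the powers of \<open>X\<close> that occur in \<open>N\<close> modulo \<open>D\<close>, whose degree is small, by repeated
  squaring.
\<close>

section \<open>Polynomially bounded quantities\<close>

text \<open>The obstacle is that \<open>n\<close> may be exponential in the input size, so the
  quotient \<open>Q\<close> can be dense and is never written down. The multiple of \<open>G\<close>
  comes from the fact that \<open>x - y\<close> divides \<open>x ^ r - y ^ r\<close>, used twice.
  With \<open>E = V ^ r - W ^ r\<close> and \<open>C = V ^ r - (U + V) ^ r\<close>, the difference
  \<open>E - C = (U + V) ^ r - W ^ r\<close> is a multiple of \<open>U + V - W = G\<close>, and
  \<open>E ^ r - C ^ r\<close> is a multiple of \<open>E - C\<close>. Two levels of powers are taken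
  because multiplication by \<open>Q\<close> spreads each term over up to \<open>n\<close>
  positions, while the gaps of \<open>G\<close> are only about \<open>n / q\<close>. The inner level
  puts \<open>W ^ r\<close> in place of \<open>W\<close> and widens the upper gap, but leaves terms
  such as \<open>U * V ^ (r - 1)\<close> close below \<open>V ^ r\<close>. These are collected in
  \<open>C\<close>, a multiple of \<open>U\<close>, and the outer level puts a factor
  \<open>U ^ r\<close> into all of \<open>C ^ r\<close>, which widens the lower gap. As
  \<open>r\<close> depends on \<open>c\<close> alone, term counts like \<open>T ^ (r * r)\<close>
  are still polynomial.\<close>

definition pbd :: "('i \<Rightarrow> nat) \<Rightarrow> 'i set \<Rightarrow> ('i \<Rightarrow> nat) \<Rightarrow> bool" where
  "pbd S A q \<longleftrightarrow> (\<exists>a b. \<forall>i\<in>A. q i \<le> a * (S i + 1) ^ b)"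

lemma pbd_mono: "pbd S A r \<Longrightarrow> (\<And>i. i \<in> A \<Longrightarrow> q i \<le> r i) \<Longrightarrow> pbd S A q"
  unfolding pbd_def by (meson le_trans)

lemma pbd_const: "pbd S A (\<lambda>_. k)"
  unfolding pbd_def by (rule exI[of _ k], rule exI[of _ 0]) simp

lemma pbd_size: "pbd S A S"
  unfolding pbd_def by (rule exI[of _ 1], rule exI[of _ 1]) simp

lemma pbd_add:
  assumes "pbd S A q" "pbd S A r" shows "pbd S A (\<lambda>i. q i + r i)"
proof -
  obtain a b c d where q: "\<And>i. i \<in> A \<Longrightarrow> q i \<le> a * (S i + 1) ^ b"
    and r: "\<And>i. i \<in> A \<Longrightarrow> r i \<le> c * (S i + 1) ^ d"
    using assms unfolding pbd_def by blast
  have "q i + r i \<le> (a + c) * (S i + 1) ^ (b + d)" if "i \<in> A" for i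
  proof -
    have "(S i + 1) ^ b \<le> (S i + 1) ^ (b + d)" "(S i + 1) ^ d \<le> (S i + 1) ^ (b + d)"
      by (auto intro: power_increasing)
    then have "a * (S i + 1) ^ b \<le> a * (S i + 1) ^ (b + d)"
      "c * (S i + 1) ^ d \<le> c * (S i + 1) ^ (b + d)" by simp_all
    with q[OF that] r[OF that] show ?thesis unfolding distrib_right by linarith
  qed
  then show ?thesis unfolding pbd_def by blast
qed

lemma pbd_mult:
  assumes "pbd S A q" "pbd S A r" shows "pbd S A (\<lambda>i. q i * r i)"
proof -
  obtain a b c d where q: "\<And>i. i \<in> A \<Longrightarrow> q i \<le> a * (S i + 1) ^ b"
    and r: "\<And>i. i \<in> A \<Longrightarrow> r i \<le> c * (S i + 1) ^ d"
    using assms unfolding pbd_def by blast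
  have "q i * r i \<le> (a * c) * (S i + 1) ^ (b + d)" if "i \<in> A" for i
    using mult_le_mono[OF q[OF that] r[OF that]] by (simp add: power_add algebra_simps)
  then show ?thesis unfolding pbd_def by blast
qed

lemma pbd_power: "pbd S A q \<Longrightarrow> pbd S A (\<lambda>i. q i ^ k)"
  by (induction k) (auto intro: pbd_const pbd_mult)

lemmas pbd_intros = pbd_const pbd_add pbd_mult

text \<open>Instances of a loop body extend an instance of the loop by a pass number or an
  accumulator. Their size remains that of the underlying instance, so all passes are measured
  against the same quantity.\<close>

lemma pbd_lift:
  "pbd S A q \<Longrightarrow> (\<And>j. j \<in> B \<Longrightarrow> h j \<in> A) \<Longrightarrow> pbd (\<lambda>j. S (h j)) B (\<lambda>j. q (h j))"
  unfolding pbd_def by blast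

lemma pbd_subset: "pbd S A q \<Longrightarrow> B \<subseteq> A \<Longrightarrow> pbd S B q"
  unfolding pbd_def by blast

text \<open>The two bounds belong to the two branches of a conditional, each known only where it is
  taken; their sum dominates both.\<close>

lemma pbd_cases:
  assumes "pbd S {i\<in>A. b i} q" "pbd S {i\<in>A. \<not> b i} q" shows "pbd S A q"
proof -
  obtain a1 b1 a2 b2 where q: "\<And>i. i \<in> A \<Longrightarrow> b i \<Longrightarrow> q i \<le> a1 * (S i + 1) ^ b1"
    "\<And>i. i \<in> A \<Longrightarrow> \<not> b i \<Longrightarrow> q i \<le> a2 * (S i + 1) ^ b2"
    using assms unfolding pbd_def by blast
  have "pbd S A (\<lambda>i. a1 * (S i + 1) ^ b1 + a2 * (S i + 1) ^ b2)"
    by (intro pbd_intros pbd_power pbd_size)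
  then show ?thesis by (rule pbd_mono) (metis q trans_le_add1 trans_le_add2)
qed

section \<open>Values computable in polynomial time\<close>

text \<open>This is the size of the unfolded tree, with shared parts counted every time. Field
  elements count 1, in agreement with their unit cost.\<close>

fun vsize :: "'a val \<Rightarrow> nat" where
  "vsize Null = 1"
| "vsize (Elt a) = 1"
| "vsize (Num k) = 1 + floorlog 2 k"
| "vsize (Cell u v) = 1 + vsize u + vsize v"

text \<open>Argument and result are held in register 0; register 1 is a stack, and all other registers
  are scratch.\<close>

definition runs :: "com \<Rightarrow> 'a::field val \<Rightarrow> nat \<Rightarrow> 'a val \<Rightarrow> bool" where
  "runs p u q v \<longleftrightarrow>
    (\<forall>s. s 0 = u \<longrightarrow> (\<exists>t s'. exec p s t s' \<and> t \<le> q \<and> s' 0 = v \<and> s' 1 = s 1))"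

text \<open>Both notions are uniform: a single program and a single polynomial bound (in the size \<open>S i\<close>)
  serve all instances \<open>i \<in> A\<close>. The size bound included in \<open>PT\<close> makes it closed under arithmetic
  without side conditions.\<close>

definition RT :: "('i \<Rightarrow> nat) \<Rightarrow> 'i set \<Rightarrow> ('i \<Rightarrow> 'a::field val) \<Rightarrow> ('i \<Rightarrow> 'a val) \<Rightarrow> bool" where
  "RT S A U V \<longleftrightarrow> (\<exists>p q. pbd S A q \<and> (\<forall>i\<in>A. runs p (U i) (q i) (V i)))"

definition PT :: "('i \<Rightarrow> nat) \<Rightarrow> 'i set \<Rightarrow> ('i \<Rightarrow> 'a::field val) \<Rightarrow> ('i \<Rightarrow> 'a val) \<Rightarrow> bool" where
  "PT S A U V \<longleftrightarrow> RT S A U V \<and> pbd S A (\<lambda>i. vsize (V i))"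

lemma PT_RT: "PT S A U V \<Longrightarrow> RT S A U V"
  and PT_size: "PT S A U V \<Longrightarrow> pbd S A (\<lambda>i. vsize (V i))"
  by (auto simp: PT_def)

lemma PT_I: "RT S A U V \<Longrightarrow> pbd S A q \<Longrightarrow> (\<And>i. i \<in> A \<Longrightarrow> vsize (V i) \<le> q i) \<Longrightarrow> PT S A U V"
  unfolding PT_def by (auto intro: pbd_mono)

section \<open>Composition of programs: sequences, pairs, tests, branches and loops\<close>

lemma runs_mono: "runs p u q v \<Longrightarrow> q \<le> q' \<Longrightarrow> runs p u q' v"
  unfolding runs_def by (metis order_trans)

lemma runs_Seq:
  fixes u :: "'a::field val"
  assumes "runs p u q v" "runs p' v q' w" shows "runs (Seq p p') u (q + q') w"
  unfolding runs_def
proof (intro allI impI)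
  fix s :: "'a store" assume "s 0 = u"
  then obtain t s1 where 1: "exec p s t s1" "t \<le> q" "s1 0 = v" "s1 1 = s 1"
    using assms(1) unfolding runs_def by blast
  then obtain t' s2 where 2: "exec p' s1 t' s2" "t' \<le> q'" "s2 0 = w" "s2 1 = s1 1"
    using assms(2) unfolding runs_def by blast
  from exec.Seq[OF 1(1) 2(1)] 1 2
  show "\<exists>t s'. exec (Seq p p') s t s' \<and> t \<le> q + q' \<and> s' 0 = w \<and> s' 1 = s 1"
    by (intro exI[of _ "t + t'"] exI[of _ s2]) simp
qed

lemma exec_Assign: "eval a s = v \<Longrightarrow> eval_cost a s = c \<Longrightarrow> exec (Assign x a) s c (s(x := v))"
  using exec.Assign by blast

lemma exec_Assign_Seq:
  "eval a s = v \<Longrightarrow> eval_cost a s = c \<Longrightarrow> exec p (s(x := v)) t s' \<Longrightarrow>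
    exec (Seq (Assign x a) p) s (c + t) s'"
  using exec.Seq[OF exec.Assign] by blast

lemma run_witness:
  "exec p s t s' \<Longrightarrow> t \<le> q \<Longrightarrow> s' 0 = v \<Longrightarrow> s' 1 = w \<Longrightarrow>
    \<exists>t s'. exec p s t s' \<and> t \<le> q \<and> s' 0 = v \<and> s' 1 = w"
  by blast

lemma RT_comp:
  assumes "RT S A U V" "RT S A V W" shows "RT S A U W"
proof -
  obtain p q p' q' where "pbd S A q" "\<forall>i\<in>A. runs p (U i) (q i) (V i)"
    "pbd S A q'" "\<forall>i\<in>A. runs p' (V i) (q' i) (W i)"
    using assms unfolding RT_def by blast
  then show ?thesis
    unfolding RT_def
    by (intro exI[of _ "Seq p p'"] exI[of _ "\<lambda>i. q i + q' i"]) (auto intro: pbd_add runs_Seq)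
qed

lemma PT_comp: "RT S A U V \<Longrightarrow> PT S A V W \<Longrightarrow> PT S A U W"
  unfolding PT_def using RT_comp by blast

lemma RT_cong: "RT S A U V \<Longrightarrow> (\<And>i. i \<in> A \<Longrightarrow> V i = V' i) \<Longrightarrow> RT S A U V'"
  unfolding RT_def by (metis)

lemma PT_cong: "PT S A U V \<Longrightarrow> (\<And>i. i \<in> A \<Longrightarrow> V i = V' i) \<Longrightarrow> PT S A U V'"
  unfolding PT_def using RT_cong by (metis (mono_tags, lifting) order_refl pbd_mono)

lemma RT_lift:
  assumes "RT S A U V" "\<And>j. j \<in> B \<Longrightarrow> h j \<in> A"
  shows "RT (\<lambda>j. S (h j)) B (\<lambda>j. U (h j)) (\<lambda>j. V (h j))"
proof -
  obtain p q where "pbd S A q" "\<forall>i\<in>A. runs p (U i) (q i) (V i)" using assms(1) unfolding RT_def by blast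
  then show ?thesis unfolding RT_def using assms(2) pbd_lift[of S A q B h]
    by (intro exI[of _ p] exI[of _ "\<lambda>j. q (h j)"]) blast
qed

lemma PT_lift:
  "PT S A U V \<Longrightarrow> (\<And>j. j \<in> B \<Longrightarrow> h j \<in> A) \<Longrightarrow> PT (\<lambda>j. S (h j)) B (\<lambda>j. U (h j)) (\<lambda>j. V (h j))"
  unfolding PT_def using RT_lift pbd_lift[of S A "\<lambda>i. vsize (V i)"] by blast

lemma PT_subset: "PT S A U V \<Longrightarrow> B \<subseteq> A \<Longrightarrow> PT S B U V"
  using PT_lift[of S A U V B "\<lambda>i. i"] by blast

lemma RT_step:
  fixes U :: "'i \<Rightarrow> 'a::field val"
  assumes "\<And>i (s :: 'a store). i \<in> A \<Longrightarrow> s 0 = U i \<Longrightarrow> \<exists>t s'. exec p s t s' \<and> t \<le> q i \<and> s' 0 = V i \<and> s' 1 = s 1"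
    and "pbd S A q"
  shows "RT S A U V"
  unfolding RT_def runs_def using assms by blast

lemma RT_assign:
  fixes U :: "'i \<Rightarrow> 'a::field val"
  assumes "\<And>i (s :: 'a store). i \<in> A \<Longrightarrow> s 0 = U i \<Longrightarrow> eval a s = V i \<and> eval_cost a s \<le> k"
  shows "RT S A U V"
proof (rule RT_step[of A U "Assign 0 a" "\<lambda>_. k"])
  fix i and s :: "'a store" assume "i \<in> A" "s 0 = U i"
  then have "eval a s = V i" "eval_cost a s \<le> k" using assms by blast+
  then show "\<exists>t s'. exec (Assign 0 a) s t s' \<and> t \<le> k \<and> s' 0 = V i \<and> s' 1 = s 1"
    by (intro run_witness[OF exec.Assign]) auto
qed (rule pbd_const)

lemma RT_id: "RT S A U U"
  by (rule RT_assign[where a = "Copy 0" and k = 1]) auto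

lemma RT_Null: "RT S A U (\<lambda>_. Null)"
  by (rule RT_assign[where a = ENull and k = 1]) auto

lemma RT_Num: "RT S A U (\<lambda>_. Num k)"
  by (rule RT_assign[where a = "NConst k" and k = "1 + floorlog 2 k"]) auto

lemma RT_Elt0: "RT S A U (\<lambda>_. Elt 0)"
  by (rule RT_assign[where a = EZero and k = 1]) auto

lemma RT_Elt1: "RT S A U (\<lambda>_. Elt 1)"
  by (rule RT_assign[where a = EOne and k = 1]) auto

lemma RT_left: "RT S A U (\<lambda>i. Cell (V i) (W i)) \<Longrightarrow> RT S A U V"
  by (erule RT_comp, rule RT_assign[where a = "ELeft 0" and k = 1]) auto

lemma RT_right: "RT S A U (\<lambda>i. Cell (V i) (W i)) \<Longrightarrow> RT S A U W"
  by (erule RT_comp, rule RT_assign[where a = "ERight 0" and k = 1]) auto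

text \<open>Only the stack survives an arbitrary program. It holds the argument while
  \<open>p\<close> runs, and then the result of \<open>p\<close> while \<open>p'\<close>
  runs.\<close>

definition pair_com :: "com \<Rightarrow> com \<Rightarrow> com" where
  "pair_com p p' =
    Seq (Assign 1 (ECell 0 1)) (Seq p
   (Seq (Assign 2 (ELeft 1)) (Seq (Assign 1 (ERight 1)) (Seq (Assign 1 (ECell 0 1))
   (Seq (Assign 0 (Copy 2)) (Seq p'
   (Seq (Assign 2 (ELeft 1)) (Seq (Assign 1 (ERight 1)) (Assign 0 (ECell 2 0))))))))))"

lemma runs_pair_com:
  fixes u :: "'a::field val"
  assumes "runs p u q v" "runs p' u q' w"
  shows "runs (pair_com p p') u (8 + q + q') (Cell v w)"
  unfolding runs_def
proof (intro allI impI)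
  fix s :: "'a store" assume s: "s 0 = u"
  let ?s1 = "s(1 := Cell u (s 1))"
  have "?s1 0 = u" using s by simp
  then obtain t s2 where 2: "exec p ?s1 t s2" "t \<le> q" "s2 0 = v" "s2 1 = Cell u (s 1)"
    using assms(1) unfolding runs_def by (metis fun_upd_same)
  let ?s3 = "s2(2 := u, 1 := s 1, 1 := Cell v (s 1), 0 := u)"
  have "?s3 0 = u" by simp
  then obtain t' s4 where 4: "exec p' ?s3 t' s4" "t' \<le> q'" "s4 0 = w" "s4 1 = ?s3 1"
    using assms(2) unfolding runs_def by meson
  let ?s5 = "s4(2 := v, 1 := s 1, 0 := Cell v w)"
  have "exec (pair_com p p') s
      (1 + (t + (1 + (1 + (1 + (1 + (t' + (1 + (1 + 1))))))))) ?s5"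
    unfolding pair_com_def
    apply (rule exec_Assign_Seq, simp add: s del: One_nat_def, simp del: One_nat_def)
    apply (rule exec.Seq[OF 2(1)])
    apply (rule exec_Assign_Seq, simp add: 2 del: One_nat_def, simp del: One_nat_def)
    apply (rule exec_Assign_Seq, simp add: 2 del: One_nat_def, simp del: One_nat_def)
    apply (rule exec_Assign_Seq, simp add: 2 del: One_nat_def, simp del: One_nat_def)
    apply (rule exec_Assign_Seq, simp add: 2 del: One_nat_def, simp del: One_nat_def)
    apply (rule exec.Seq[OF 4(1)])
    apply (rule exec_Assign_Seq, simp add: 4 del: One_nat_def, simp del: One_nat_def)
    apply (rule exec_Assign_Seq, simp add: 4 del: One_nat_def, simp del: One_nat_def)
    apply (rule exec_Assign, simp add: 4 del: One_nat_def, simp del: One_nat_def)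
    done
  then show "\<exists>t s'. exec (pair_com p p') s t s' \<and> t \<le> 8 + q + q' \<and> s' 0 = Cell v w \<and> s' 1 = s 1"
    by (rule run_witness) (use 2 4 in auto)
qed

lemma RT_pair:
  assumes "RT S A U V" "RT S A U W" shows "RT S A U (\<lambda>i. Cell (V i) (W i))"
proof -
  obtain p q p' q' where "pbd S A q" "\<forall>i\<in>A. runs p (U i) (q i) (V i)"
    "pbd S A q'" "\<forall>i\<in>A. runs p' (U i) (q' i) (W i)"
    using assms unfolding RT_def by blast
  then show ?thesis
    unfolding RT_def
    by (intro exI[of _ "pair_com p p'"] exI[of _ "\<lambda>i. 8 + q i + q' i"])
       (auto intro!: pbd_intros runs_pair_com)
qed

text \<open>The computation of one operand may overwrite the scratch registers, so the operands are
  produced as a pair and unpacked into registers 2 and 3 just before \<open>a\<close> is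
  evaluated.\<close>

lemma RT_bin:
  fixes U :: "'i \<Rightarrow> 'a::field val"
  assumes VW: "RT S A U V" "RT S A U W"
    and ev: "\<And>i (s :: 'a store). i \<in> A \<Longrightarrow> s 2 = V i \<Longrightarrow> s 3 = W i \<Longrightarrow> eval a s = Z i \<and> eval_cost a s \<le> q i"
    and q: "pbd S A q"
  shows "RT S A U Z"
proof (rule RT_comp[OF RT_pair[OF VW]], rule RT_step)
  let ?p = "Seq (Assign 2 (ELeft 0)) (Seq (Assign 3 (ERight 0)) (Assign 0 a))"
  fix i and s :: "'a store" assume i: "i \<in> A" "s 0 = Cell (V i) (W i)"
  let ?s = "s(2 := V i, 3 := W i)"
  have ev': "eval a ?s = Z i \<and> eval_cost a ?s \<le> q i" using ev[OF i(1), of ?s] by simp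
  have "exec ?p s (1 + (1 + eval_cost a ?s)) (?s(0 := eval a ?s))"
    by (rule exec_Assign_Seq, simp add: i, simp, rule exec_Assign_Seq, simp add: i, simp)
      (rule exec.Assign)
  then show "\<exists>t s'. exec ?p s t s' \<and> t \<le> 2 + q i \<and> s' 0 = Z i \<and> s' 1 = s 1"
    by (rule run_witness) (use ev' in auto)
qed (use q in \<open>intro pbd_intros\<close>)

abbreviation Bit :: "bool \<Rightarrow> 'a val" where
  "Bit b \<equiv> Num (if b then 1 else 0)"

lemma floorlog_1 [simp]: "floorlog 2 (Suc 0) = 1"
  by (simp add: floorlog_def)

lemma floorlog_0 [simp]: "floorlog b 0 = 0"
  by (simp add: floorlog_def)

lemma RT_test:
  fixes U :: "'i \<Rightarrow> 'a::field val"
  assumes VW: "RT S A U V" "RT S A U W"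
    and ev: "\<And>i (s :: 'a store). i \<in> A \<Longrightarrow> s 2 = V i \<Longrightarrow> s 3 = W i \<Longrightarrow> holds b s = Q i \<and> test_cost b s \<le> q i"
    and q: "pbd S A q"
  shows "RT S A U (\<lambda>i. Bit (Q i))"
proof (rule RT_comp[OF RT_pair[OF VW]], rule RT_step)
  let ?c = "Cond b (Assign 0 (NConst 1)) (Assign 0 (NConst 0))"
  let ?p = "Seq (Assign 2 (ELeft 0)) (Seq (Assign 3 (ERight 0)) ?c)"
  fix i and s :: "'a store" assume i: "i \<in> A" "s 0 = Cell (V i) (W i)"
  let ?s = "s(2 := V i, 3 := W i)"
  have ev': "holds b ?s = Q i \<and> test_cost b ?s \<le> q i" using ev[OF i(1), of ?s] by simp
  have "exec ?c ?s (test_cost b ?s + (if Q i then 2 else 1)) (?s(0 := Bit (Q i)))"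
  proof (cases "Q i")
    case True
    have "exec ?c ?s (test_cost b ?s + 2) (?s(0 := Num 1))"
      by (rule exec.CondTrue) (use ev' True in \<open>auto intro!: exec_Assign\<close>)
    with True show ?thesis by simp
  next
    case False
    have "exec ?c ?s (test_cost b ?s + 1) (?s(0 := Num 0))"
      by (rule exec.CondFalse) (use ev' False in \<open>auto intro!: exec_Assign\<close>)
    with False show ?thesis by simp
  qed
  moreover have "test_cost b ?s + (if Q i then 2 else 1) \<le> q i + 2"
    using ev' by simp
  ultimately obtain t where t: "exec ?c ?s t (?s(0 := Bit (Q i)))" "t \<le> q i + 2" by blast
  have "exec ?p s (1 + (1 + t)) (?s(0 := Bit (Q i)))"
    by (rule exec_Assign_Seq, simp add: i, simp, rule exec_Assign_Seq, simp add: i, simp) (rule t(1))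
  then show "\<exists>t s'. exec ?p s t s' \<and> t \<le> 4 + q i \<and> s' 0 = Bit (Q i) \<and> s' 1 = s 1"
    by (rule run_witness) (use t in auto)
qed (use q in \<open>intro pbd_intros\<close>)

text \<open>The condition has already been evaluated and arrives as a bit paired with the argument;
  the chosen branch receives the bare argument.\<close>

definition cond_com :: "com \<Rightarrow> com \<Rightarrow> com" where
  "cond_com p p' = Seq (Assign 2 (ELeft 0)) (Seq (Assign 3 (NConst 0)) (Seq (Assign 0 (ERight 0))
     (Cond (NLess 3 2) p p')))"

lemma runs_cond_com:
  fixes u :: "'a::field val"
  assumes "b \<Longrightarrow> runs p u q v" "\<not> b \<Longrightarrow> runs p' u q v"
  shows "runs (cond_com p p') (Cell (Bit b) u) (5 + q) v"
  unfolding runs_def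
proof (intro allI impI)
  fix s :: "'a store" assume s: "s 0 = Cell (Bit b) u"
  let ?s = "s(2 := Bit b, 3 := Num 0, 0 := u)"
  have "\<exists>t s'. exec (Cond (NLess 3 2) p p') ?s t s' \<and> t \<le> 2 + q \<and> s' 0 = v \<and> s' 1 = s 1"
  proof (cases b)
    case True
    then obtain t s' where 1: "exec p ?s t s'" "t \<le> q" "s' 0 = v" "s' 1 = ?s 1"
      using assms(1) unfolding runs_def by (metis fun_upd_same)
    have "exec (Cond (NLess 3 2) p p') ?s (test_cost (NLess 3 2) ?s + t) s'"
      by (rule exec.CondTrue) (use True 1 in auto)
    then show ?thesis by (rule run_witness) (use 1 True in auto)
  next
    case False
    then obtain t s' where 1: "exec p' ?s t s'" "t \<le> q" "s' 0 = v" "s' 1 = ?s 1"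
      using assms(2) unfolding runs_def by (metis fun_upd_same)
    have "exec (Cond (NLess 3 2) p p') ?s (test_cost (NLess 3 2) ?s + t) s'"
      by (rule exec.CondFalse) (use False 1 in auto)
    then show ?thesis by (rule run_witness) (use 1 False in auto)
  qed
  then obtain t s' where t: "exec (Cond (NLess 3 2) p p') ?s t s'" "t \<le> 2 + q" "s' 0 = v" "s' 1 = s 1"
    by blast
  have "exec (cond_com p p') s (1 + (1 + (1 + t))) s'"
    unfolding cond_com_def
    by (rule exec_Assign_Seq, simp add: s, simp, rule exec_Assign_Seq, simp, simp,
        rule exec_Assign_Seq, simp add: s, simp) (rule t(1))
  then show "\<exists>t s'. exec (cond_com p p') s t s' \<and> t \<le> 5 + q \<and> s' 0 = v \<and> s' 1 = s 1"
    by (rule run_witness) (use t in auto)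
qed

text \<open>Each branch has to be polynomial only on the instances that reach it. The decision
  procedure depends on this, since long division is affordable only when \<open>n\<close> is
  small.\<close>

lemma RT_if:
  assumes "RT S A U (\<lambda>i. Bit (b i))" "RT S {i\<in>A. b i} U V" "RT S {i\<in>A. \<not> b i} U W"
  shows "RT S A U (\<lambda>i. if b i then V i else W i)"
proof -
  obtain p q p' q' where q: "pbd S {i\<in>A. b i} q" "pbd S {i\<in>A. \<not> b i} q'"
    and p: "\<forall>i\<in>{i\<in>A. b i}. runs p (U i) (q i) (V i)" "\<forall>i\<in>{i\<in>A. \<not> b i}. runs p' (U i) (q' i) (W i)"
    using assms(2,3) unfolding RT_def by blast
  let ?q = "\<lambda>i. if b i then q i else q' i"
  have "pbd S {i\<in>A. b i} ?q" "pbd S {i\<in>A. \<not> b i} ?q"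
    by (rule pbd_mono[OF q(1)], simp, rule pbd_mono[OF q(2)], simp)
  then have "pbd S A ?q" by (rule pbd_cases)
  then have "RT S A (\<lambda>i. Cell (Bit (b i)) (U i)) (\<lambda>i. if b i then V i else W i)"
    unfolding RT_def
    by (intro exI[of _ "cond_com p p'"] exI[of _ "\<lambda>i. 5 + ?q i"] conjI pbd_intros ballI
        runs_cond_com) (use p in \<open>auto simp: pbd_const\<close>)
  with RT_pair[OF assms(1) RT_id] show ?thesis by (rule RT_comp)
qed

text \<open>The state in register 0 carries its own continuation flag as left component. Registers 2
  and 3 are set anew after every pass because the body may overwrite them.\<close>

definition loop_com :: "com \<Rightarrow> com" where
  "loop_com p = While (NLess 3 2) (Seq p (Seq (Assign 2 (ELeft 0)) (Assign 3 (NConst 0))))"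

text \<open>Induction on the number \<open>d\<close> of remaining passes. A pass costs at most
  \<open>q\<close> for the body, 2 for the successful test of a bit, and 2 to restore the registers;
  the final failing test costs 1.\<close>

lemma exec_loop_com:
  fixes s :: "'a::field store"
  assumes "\<And>n. n < N \<Longrightarrow> runs p (st n) q (st (Suc n))"
    and "\<And>n. n \<le> N \<Longrightarrow> left_of (st n) = Bit (n < N)"
    and "d \<le> N" "s 0 = st (N - d)" "s 2 = Bit (N - d < N)" "s 3 = Num 0"
  shows "\<exists>t s'. exec (loop_com p) s t s' \<and> t \<le> 1 + d * (4 + q) \<and> s' 0 = st N \<and> s' 1 = s 1"
  using assms(3-6)
proof (induction d arbitrary: s)
  case 0
  then have "exec (loop_com p) s (test_cost (NLess 3 2) s) s"
    unfolding loop_com_def by (intro exec.WhileFalse) auto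
  then show ?case by (rule run_witness) (use 0 in auto)
next
  case (Suc d)
  let ?n = "N - Suc d"
  let ?b = "Seq p (Seq (Assign 2 (ELeft 0)) (Assign 3 (NConst 0)))"
  have n: "?n < N" "N - d = Suc ?n" using Suc.prems by auto
  with assms(1) Suc.prems obtain t s1 where
    1: "exec p s t s1" "t \<le> q" "s1 0 = st (N - d)" "s1 1 = s 1"
    unfolding runs_def by metis
  let ?s2 = "s1(2 := left_of (s1 0), 3 := Num 0)"
  have "exec (Seq (Assign 2 (ELeft 0)) (Assign 3 (NConst 0))) s1 2 ?s2"
    unfolding one_add_one[symmetric]
    by (rule exec_Assign_Seq, simp, simp, rule exec_Assign) simp_all
  with 1 have b: "exec ?b s (t + 2) ?s2" by (intro exec.Seq)
  have "\<exists>t s'. exec (loop_com p) ?s2 t s' \<and> t \<le> 1 + d * (4 + q) \<and> s' 0 = st N \<and> s' 1 = ?s2 1"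
  proof (rule Suc.IH)
    show "?s2 2 = Bit (N - d < N)" using assms(2)[of "N - d"] 1(3) by simp
  qed (use 1(3) Suc.prems(1) in simp_all)
  then obtain t' s' where 2: "exec (loop_com p) ?s2 t' s'" "t' \<le> 1 + d * (4 + q)"
    "s' 0 = st N" "s' 1 = ?s2 1" by blast
  have h: "holds (NLess 3 2) s" and c: "test_cost (NLess 3 2) s = 2"
    using Suc.prems(3,4) n(1) by simp_all
  have e: "exec (loop_com p) s (2 + (t + 2) + t') s'"
    using exec.WhileTrue[OF h b 2(1)[unfolded loop_com_def]] unfolding c loop_com_def .
  have le: "2 + (t + 2) + t' \<le> 1 + Suc d * (4 + q)"
    using 1(2) 2(2) unfolding mult_Suc by linarith
  show ?case by (rule run_witness[OF e le]) (use 2(3,4) 1(4) in simp_all)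
qed

text \<open>The body is a family of instances \<open>(i, n)\<close> whose size is still that of
  \<open>i\<close>. Its bound is therefore uniform over the passes, and multiplication by the number
  of passes keeps it polynomial.\<close>

lemma RT_loop:
  fixes st :: "'i \<Rightarrow> nat \<Rightarrow> 'a::field val"
  assumes N: "pbd S A N"
    and body: "RT (\<lambda>j. S (fst j)) {(i, n). i \<in> A \<and> n < N i} (\<lambda>j. st (fst j) (snd j))
        (\<lambda>j. st (fst j) (Suc (snd j)))"
    and flag: "\<And>i n. i \<in> A \<Longrightarrow> n \<le> N i \<Longrightarrow> left_of (st i n) = Bit (n < N i)"
  shows "RT S A (\<lambda>i. st i 0) (\<lambda>i. st i (N i))"
proof -
  let ?A = "{(i, n). i \<in> A \<and> n < N i}"
  obtain p q where "pbd (\<lambda>j. S (fst j)) ?A q"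
    and r: "\<And>j. j \<in> ?A \<Longrightarrow> runs p (st (fst j) (snd j)) (q j) (st (fst j) (Suc (snd j)))"
    using body unfolding RT_def by blast
  then obtain a b where q: "\<And>j. j \<in> ?A \<Longrightarrow> q j \<le> a * (S (fst j) + 1) ^ b"
    unfolding pbd_def by blast
  then have p: "runs p (st i n) (a * (S i + 1) ^ b) (st i (Suc n))" if "i \<in> A" "n < N i" for i n
    using runs_mono[OF r[of "(i, n)"]] that q[of "(i, n)"] by simp
  let ?q = "\<lambda>i. 3 + N i * (4 + a * (S i + 1) ^ b)"
  let ?p = "Seq (Assign 2 (ELeft 0)) (Seq (Assign 3 (NConst 0)) (loop_com p))"
  show ?thesis
  proof (rule RT_step[where p = ?p and q = ?q])
    fix i and s :: "'a store" assume i: "i \<in> A" "s 0 = st i 0"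
    let ?s = "s(2 := left_of (s 0), 3 := Num 0)"
    have "\<exists>t s'. exec (loop_com p) ?s t s' \<and> t \<le> 1 + N i * (4 + a * (S i + 1) ^ b)
        \<and> s' 0 = st i (N i) \<and> s' 1 = ?s 1"
      by (rule exec_loop_com[where st = "st i"]) (use i p flag[OF i(1)] flag[OF i(1), of 0] in simp_all)
    then obtain t s' where t: "exec (loop_com p) ?s t s'" "t \<le> 1 + N i * (4 + a * (S i + 1) ^ b)"
      "s' 0 = st i (N i)" "s' 1 = ?s 1" by blast
    have "exec ?p s (1 + (1 + t)) s'"
      by (rule exec_Assign_Seq, simp, simp, rule exec_Assign_Seq, simp, simp) (rule t(1))
    then show "\<exists>t s'. exec ?p s t s' \<and> t \<le> ?q i \<and> s' 0 = st i (N i) \<and> s' 1 = s 1"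
      by (rule run_witness) (use t in auto)
  next
    show "pbd S A ?q"
      by (intro pbd_intros N pbd_power pbd_size)
  qed
qed

section \<open>Bit lengths, arithmetic and boolean operations\<close>

lemma less_2_power_floorlog: "x < 2 ^ floorlog 2 x"
  using floorlog_le_iff[of 2 x "floorlog 2 x"] by simp

lemma floorlog_add_le: "floorlog 2 (x + y) \<le> 1 + floorlog 2 x + floorlog 2 y"
proof -
  let ?a = "floorlog 2 x" and ?b = "floorlog 2 y"
  have "(2::nat) ^ ?a \<le> 2 ^ (?a + ?b)" "(2::nat) ^ ?b \<le> 2 ^ (?a + ?b)"
    by (intro power_increasing; simp)+
  with less_2_power_floorlog[of x] less_2_power_floorlog[of y]
  have "x + y < 2 ^ (1 + ?a + ?b)"
    unfolding add.assoc plus_1_eq_Suc add_Suc power_Suc by linarith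
  then show ?thesis by (intro floorlog_leI) auto
qed

lemma floorlog_mult_le: "floorlog 2 (x * y) \<le> floorlog 2 x + floorlog 2 y"
  by (intro floorlog_leI, unfold power_add, intro mult_strict_mono less_2_power_floorlog) auto

lemma floorlog_le_self: "floorlog 2 x \<le> x"
  by (intro floorlog_leI less_exp) auto

lemma vsize_pos: "vsize v > 0"
  by (cases v) auto

lemma PT_Num_const: "PT S A U (\<lambda>_. Num k)"
  unfolding PT_def by (simp add: RT_Num pbd_const)

lemma PT_Null: "PT S A U (\<lambda>_. Null)"
  unfolding PT_def by (simp add: RT_Null pbd_const)

lemma PT_Elt0: "PT S A U (\<lambda>_. Elt 0)"
  unfolding PT_def by (simp add: RT_Elt0 pbd_const)

lemma PT_Elt1: "PT S A U (\<lambda>_. Elt 1)"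
  unfolding PT_def by (simp add: RT_Elt1 pbd_const)

lemma PT_pair: "PT S A U V \<Longrightarrow> PT S A U W \<Longrightarrow> PT S A U (\<lambda>i. Cell (V i) (W i))"
  unfolding PT_def by (simp add: RT_pair pbd_intros del: add_Suc One_nat_def flip: plus_1_eq_Suc)

lemma PT_left: "PT S A U (\<lambda>i. Cell (V i) (W i)) \<Longrightarrow> PT S A U V"
  by (rule PT_I[OF RT_left[OF PT_RT] PT_size]) auto

lemma PT_right: "PT S A U (\<lambda>i. Cell (V i) (W i)) \<Longrightarrow> PT S A U W"
  by (rule PT_I[OF RT_right[OF PT_RT] PT_size]) auto

lemma PT_bits: "PT S A U (\<lambda>i. Num (x i)) \<Longrightarrow> pbd S A (\<lambda>i. floorlog 2 (x i))"
  by (drule PT_size, erule pbd_mono) simp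

lemma PT_add:
  assumes "PT S A U (\<lambda>i. Num (x i))" "PT S A U (\<lambda>i. Num (y i))"
  shows "PT S A U (\<lambda>i. Num (x i + y i))"
proof (rule PT_I)
  show "RT S A U (\<lambda>i. Num (x i + y i))"
    by (rule RT_bin[OF assms[THEN PT_RT], where a = "NAdd 2 3"
        and q = "\<lambda>i. 1 + floorlog 2 (x i) + floorlog 2 (y i)"])
       (auto intro!: pbd_intros PT_bits assms simp del: One_nat_def add_Suc)
  show "pbd S A (\<lambda>i. 2 + floorlog 2 (x i) + floorlog 2 (y i))"
    by (intro pbd_intros assms[THEN PT_bits])
  show "vsize (Num (x i + y i)) \<le> 2 + floorlog 2 (x i) + floorlog 2 (y i)" for i
    using floorlog_add_le[of "x i" "y i"] by simp
qed

lemma PT_sub: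
  assumes "PT S A U (\<lambda>i. Num (x i))" "PT S A U (\<lambda>i. Num (y i))"
  shows "PT S A U (\<lambda>i. Num (x i - y i))"
  by (rule PT_I[where q = "\<lambda>i. 1 + floorlog 2 (x i)"],
      rule RT_bin[OF assms[THEN PT_RT], where a = "NSub 2 3"
        and q = "\<lambda>i. 1 + floorlog 2 (x i) + floorlog 2 (y i)"])
     (auto intro!: floorlog_mono pbd_intros PT_bits assms simp del: One_nat_def add_Suc)

lemma PT_mult:
  assumes "PT S A U (\<lambda>i. Num (x i))" "PT S A U (\<lambda>i. Num (y i))"
  shows "PT S A U (\<lambda>i. Num (x i * y i))"
  by (rule PT_I[where q = "\<lambda>i. 1 + floorlog 2 (x i) + floorlog 2 (y i)"],
      rule RT_bin[OF assms[THEN PT_RT], where a = "NMul 2 3"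
        and q = "\<lambda>i. (1 + floorlog 2 (x i)) * (1 + floorlog 2 (y i))"])
     (use floorlog_mult_le in \<open>auto intro!: pbd_intros PT_bits assms simp del: One_nat_def add_Suc\<close>)

lemma PT_div:
  assumes "PT S A U (\<lambda>i. Num (x i))" "PT S A U (\<lambda>i. Num (y i))"
  shows "PT S A U (\<lambda>i. Num (x i div y i))"
  by (rule PT_I[where q = "\<lambda>i. 1 + floorlog 2 (x i)"],
      rule RT_bin[OF assms[THEN PT_RT], where a = "NDiv 2 3"
        and q = "\<lambda>i. (1 + floorlog 2 (x i)) * (1 + floorlog 2 (y i))"])
     (auto intro!: floorlog_mono pbd_intros PT_bits assms simp del: One_nat_def add_Suc)

lemma PT_mod:
  assumes "PT S A U (\<lambda>i. Num (x i))" "PT S A U (\<lambda>i. Num (y i))"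
  shows "PT S A U (\<lambda>i. Num (x i mod y i))"
  unfolding minus_div_mult_eq_mod[symmetric] by (intro PT_sub PT_mult PT_div assms)

lemma PT_Elt_bin:
  assumes "PT S A U (\<lambda>i. Elt (x i))" "PT S A U (\<lambda>i. Elt (y i))"
  shows PT_Elt_add: "PT S A U (\<lambda>i. Elt (x i + y i))"
    and PT_Elt_sub: "PT S A U (\<lambda>i. Elt (x i - y i))"
    and PT_Elt_mult: "PT S A U (\<lambda>i. Elt (x i * y i))"
    and PT_Elt_div: "PT S A U (\<lambda>i. Elt (x i / y i))"
proof -
  have *: "PT S A U V" if "RT S A U V" "\<And>i. vsize (V i) \<le> 1" for V
    using that by (intro PT_I[OF _ pbd_const[of _ _ 1]]) auto
  show "PT S A U (\<lambda>i. Elt (x i + y i))"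
    by (rule *, rule RT_bin[OF assms[THEN PT_RT], where a = "EAdd 2 3" and q = "\<lambda>_. 1"]) (auto simp: pbd_const)
  show "PT S A U (\<lambda>i. Elt (x i - y i))"
    by (rule *, rule RT_bin[OF assms[THEN PT_RT], where a = "ESub 2 3" and q = "\<lambda>_. 1"]) (auto simp: pbd_const)
  show "PT S A U (\<lambda>i. Elt (x i * y i))"
    by (rule *, rule RT_bin[OF assms[THEN PT_RT], where a = "EMul 2 3" and q = "\<lambda>_. 1"]) (auto simp: pbd_const)
  show "PT S A U (\<lambda>i. Elt (x i / y i))"
    by (rule *, rule RT_bin[OF assms[THEN PT_RT], where a = "EDiv 2 3" and q = "\<lambda>_. 1"]) (auto simp: pbd_const)
qed

lemma PT_Bit_I: "RT S A U (\<lambda>i. Bit (b i)) \<Longrightarrow> PT S A U (\<lambda>i. Bit (b i))"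
  by (erule PT_I[OF _ pbd_const[of _ _ 2]]) simp

lemma PT_less:
  assumes "PT S A U (\<lambda>i. Num (x i))" "PT S A U (\<lambda>i. Num (y i))"
  shows "PT S A U (\<lambda>i. Bit (x i < y i))"
  by (rule PT_Bit_I, rule RT_test[OF assms[THEN PT_RT], where b = "NLess 2 3"
        and q = "\<lambda>i. 1 + floorlog 2 (x i) + floorlog 2 (y i)"])
     (auto intro!: pbd_intros PT_bits assms simp del: One_nat_def add_Suc)

lemma RT_is_Null: "RT S A U V \<Longrightarrow> RT S A U (\<lambda>i. Bit (V i = Null))"
  by (erule RT_test[OF _ RT_Null, where b = "IsNull 2" and q = "\<lambda>_. 1"]) (auto simp: pbd_const)

lemma PT_is_zero: "PT S A U (\<lambda>i. Elt (x i)) \<Longrightarrow> PT S A U (\<lambda>i. Bit (x i = 0))"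
  by (rule PT_Bit_I, rule RT_test[OF PT_RT RT_Null, where b = "IsZero 2" and q = "\<lambda>_. 1"]) (auto simp: pbd_const)

lemma PT_if_rel:
  assumes "PT S A U (\<lambda>i. Bit (b i))" "PT S {i\<in>A. b i} U V" "PT S {i\<in>A. \<not> b i} U W"
  shows "PT S A U (\<lambda>i. if b i then V i else W i)"
proof -
  have "pbd S A (\<lambda>i. vsize (if b i then V i else W i))"
    by (rule pbd_cases[where b = b]; rule pbd_mono[OF PT_size], rule assms(2,3)) auto
  then show ?thesis using assms unfolding PT_def by (blast intro: RT_if)
qed

lemma PT_if:
  assumes "PT S A U (\<lambda>i. Bit (b i))" "PT S A U V" "PT S A U W"
  shows "PT S A U (\<lambda>i. if b i then V i else W i)"
  using assms by (intro PT_if_rel) (auto intro: PT_subset)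

lemma PT_if':
  assumes "PT S A U (\<lambda>i. Bit (b i))" "PT S A U (\<lambda>i. e (x i))" "PT S A U (\<lambda>i. e (y i))"
  shows "PT S A U (\<lambda>i. e (if b i then x i else y i))"
  using PT_if[OF assms] by (rule PT_cong) simp

lemma PT_not:
  assumes "PT S A U (\<lambda>i. Bit (b i))" shows "PT S A U (\<lambda>i. Bit (\<not> b i))"
  using PT_if[OF assms PT_Num_const[of _ _ _ 0] PT_Num_const[of _ _ _ 1]] by (rule PT_cong) simp

lemma PT_conj:
  assumes "PT S A U (\<lambda>i. Bit (b i))" "PT S A U (\<lambda>i. Bit (c i))"
  shows "PT S A U (\<lambda>i. Bit (b i \<and> c i))"
  using PT_if[OF assms(1) assms(2) PT_Num_const[of _ _ _ 0]] by (rule PT_cong) simp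

lemma PT_imp:
  assumes "PT S A U (\<lambda>i. Bit (b i))" "PT S A U (\<lambda>i. Bit (c i))"
  shows "PT S A U (\<lambda>i. Bit (b i \<longrightarrow> c i))"
  using PT_if[OF assms(1) assms(2) PT_Num_const[of _ _ _ 1]] by (rule PT_cong) simp

lemma PT_le:
  assumes "PT S A U (\<lambda>i. Num (x i))" "PT S A U (\<lambda>i. Num (y i))"
  shows "PT S A U (\<lambda>i. Bit (x i \<le> y i))"
  using PT_not[OF PT_less[OF assms(2,1)]] by (rule PT_cong) auto

lemma PT_eq:
  assumes "PT S A U (\<lambda>i. Num (x i))" "PT S A U (\<lambda>i. Num (y i))"
  shows "PT S A U (\<lambda>i. Bit (x i = y i))"
  using PT_conj[OF PT_le[OF assms] PT_le[OF assms(2,1)]] by (rule PT_cong) auto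

section \<open>Recursion over lists\<close>

fun vl :: "('x \<Rightarrow> 'a val) \<Rightarrow> 'x list \<Rightarrow> 'a val" where
  "vl e [] = Null"
| "vl e (x # xs) = Cell (e x) (vl e xs)"

lemma vl_eq_Null_iff [simp]: "vl e xs = Null \<longleftrightarrow> xs = []"
  by (cases xs) auto

lemma length_le_vsize_vl: "length xs \<le> vsize (vl e xs)"
  by (induction xs) auto

lemma vsize_le_vsize_vl: "x \<in> set xs \<Longrightarrow> vsize (e x) \<le> vsize (vl e xs)"
  by (induction xs) (auto intro: le_SucI trans_le_add1 trans_le_add2)

lemma vsize_vl_append: "vsize (vl e (xs @ ys)) = vsize (vl e xs) + vsize (vl e ys) - 1"
  by (induction xs) (use vsize_pos[of "vl e ys"] in auto)

lemma vsize_vl_append_le: "vsize (vl e (xs @ ys)) \<le> vsize (vl e xs) + vsize (vl e ys)"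
  by (simp add: vsize_vl_append)

lemma vsize_vl_rev: "vsize (vl e (rev xs)) = vsize (vl e xs)"
  by (induction xs) (auto simp: vsize_vl_append)

lemma vsize_vl_le:
  "(\<And>x. x \<in> set xs \<Longrightarrow> vsize (e x) \<le> k) \<Longrightarrow> vsize (vl e xs) \<le> 1 + length xs * (1 + k)"
proof (induction xs)
  case (Cons x xs)
  then have "vsize (vl e xs) \<le> 1 + length xs * (1 + k)" "vsize (e x) \<le> k" by auto
  then show ?case by simp
qed simp

lemma PT_length: "PT S A U (\<lambda>i. vl e (xs i)) \<Longrightarrow> pbd S A (\<lambda>i. length (xs i))"
  by (drule PT_size, erule pbd_mono) (rule length_le_vsize_vl)

lemma RT_nonempty:
  assumes "RT S A U (\<lambda>i. vl e (xs i))" shows "RT S A U (\<lambda>i. Bit (xs i \<noteq> []))"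
proof -
  have "RT S A U (\<lambda>i. if vl e (xs i) = Null then Num 0 else Num 1)"
    by (intro RT_if RT_is_Null assms RT_Num)
  then show ?thesis by (rule RT_cong) simp
qed

text \<open>The instances of the body of a fold are triples of an instance of the fold, a reachable
  accumulator and the next element.\<close>

definition fold_inst :: "'i set \<Rightarrow> ('i \<Rightarrow> 'x list) \<Rightarrow> ('i \<Rightarrow> 'b \<Rightarrow> 'x \<Rightarrow> 'b) \<Rightarrow> ('i \<Rightarrow> 'b) \<Rightarrow>
    ('i \<times> 'b \<times> 'x) set" where
  "fold_inst A xs f a = {(i, b, x). i \<in> A \<and> (\<exists>ys zs. xs i = ys @ x # zs \<and> b = foldl (f i) (a i) ys)}"

text \<open>The loop state keeps the original argument \<open>U i\<close> beside the remaining list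
  and the accumulator, so that the step can refer to all parameters of the instance.\<close>

lemma RT_foldl:
  fixes U :: "'i \<Rightarrow> 'a::field val"
  assumes len: "pbd S A (\<lambda>i. length (xs i))"
    and xs: "RT S A U (\<lambda>i. vl ex (xs i))" and a: "RT S A U (\<lambda>i. eb (a i))"
    and step: "RT (\<lambda>j. S (fst j)) (fold_inst A xs f a)
      (\<lambda>j. Cell (U (fst j)) (Cell (eb (fst (snd j))) (ex (snd (snd j)))))
      (\<lambda>j. eb (f (fst j) (fst (snd j)) (snd (snd j))))"
  shows "RT S A U (\<lambda>i. eb (foldl (f i) (a i) (xs i)))"
proof -
  define acc where "acc i n = foldl (f i) (a i) (take n (xs i))" for i n
  define st where "st i n = Cell (Bit (n < length (xs i)))
    (Cell (vl ex (drop n (xs i))) (Cell (eb (acc i n)) (U i)))" for i n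
  let ?A = "{(i, n). i \<in> A \<and> n < length (xs i)}"
  let ?W = "\<lambda>j. st (fst j) (snd j)" and ?S = "\<lambda>j :: 'i \<times> nat. S (fst j)"
  have "RT ?S ?A ?W ?W" by (rule RT_id)
  then have W: "RT ?S ?A ?W (\<lambda>j. Cell (vl ex (drop (snd j) (xs (fst j))))
      (Cell (eb (acc (fst j) (snd j))) (U (fst j))))"
    unfolding st_def by (rule RT_right)
  have "RT ?S ?A ?W (\<lambda>j. Cell (ex (xs (fst j) ! snd j)) (vl ex (drop (Suc (snd j)) (xs (fst j)))))"
    using RT_left[OF W] by (rule RT_cong) (auto simp flip: Cons_nth_drop_Suc)
  note x = RT_left[OF this] and rest = RT_right[OF this]
  have "RT ?S ?A (\<lambda>j. Cell (U (fst j)) (Cell (eb (acc (fst j) (snd j))) (ex (xs (fst j) ! snd j))))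
     (\<lambda>j. eb (f (fst j) (acc (fst j) (snd j)) (xs (fst j) ! snd j)))"
    by (rule RT_lift[OF step, where h = "\<lambda>j. (fst j, acc (fst j) (snd j), xs (fst j) ! snd j)", simplified])
       (auto simp: fold_inst_def acc_def, blast intro: id_take_nth_drop)
  with RT_pair[OF RT_right[OF RT_right[OF W]] RT_pair[OF RT_left[OF RT_right[OF W]] x]]
  have "RT ?S ?A ?W (\<lambda>j. eb (f (fst j) (acc (fst j) (snd j)) (xs (fst j) ! snd j)))"
    by (rule RT_comp)
  then have acc: "RT ?S ?A ?W (\<lambda>j. eb (acc (fst j) (Suc (snd j))))"
    by (rule RT_cong) (auto simp: acc_def take_Suc_conv_app_nth)
  have "RT ?S ?A ?W (\<lambda>j. Bit (Suc (snd j) < length (xs (fst j))))"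
    using RT_nonempty[OF rest] by (rule RT_cong) auto
  from RT_pair[OF this RT_pair[OF rest RT_pair[OF acc RT_right[OF RT_right[OF W]]]]]
  have body: "RT ?S ?A ?W (\<lambda>j. st (fst j) (Suc (snd j)))"
    unfolding st_def .
  have "RT S A U (\<lambda>i. Bit (0 < length (xs i)))"
    using RT_nonempty[OF xs] by (rule RT_cong) auto
  from RT_pair[OF this RT_pair[OF xs RT_pair[OF a RT_id]]]
  have init: "RT S A U (\<lambda>i. st i 0)"
    by (rule RT_cong) (simp add: st_def acc_def)
  have "RT S A (\<lambda>i. st i 0) (\<lambda>i. st i (length (xs i)))"
    by (rule RT_loop[OF len body]) (simp add: st_def)
  then have "RT S A U (\<lambda>i. st i (length (xs i)))"
    by (rule RT_comp[OF init])
  then have "RT S A U (\<lambda>i. eb (acc i (length (xs i))))"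
    unfolding st_def by (elim RT_left[OF RT_right[OF RT_right]])
  then show ?thesis by (rule RT_cong) (simp add: acc_def)
qed

section \<open>Operations on lists and enumeration of numbers\<close>

lemma PT_rev:
  assumes "PT S A U (\<lambda>i. vl e (xs i))" shows "PT S A U (\<lambda>i. vl e (rev (xs i)))"
proof -
  have "RT S A U (\<lambda>i. vl e (foldl (\<lambda>acc x. x # acc) [] (xs i)))"
  proof (rule RT_foldl[OF PT_length[OF assms] PT_RT[OF assms]])
    let ?U = "\<lambda>j. Cell (U (fst j)) (Cell (vl e (fst (snd j))) (e (snd (snd j))))"
    let ?A = "fold_inst A xs (\<lambda>_ acc x. x # acc) (\<lambda>_. [])"
    have id: "RT (\<lambda>j. S (fst j)) ?A ?U ?U" by (rule RT_id)
    show "RT (\<lambda>j. S (fst j)) ?A ?U (\<lambda>j. vl e (snd (snd j) # fst (snd j)))"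
      unfolding vl.simps
      by (rule RT_pair[OF RT_right[OF RT_right[OF id]] RT_left[OF RT_right[OF id]]])
  qed (simp add: RT_Null)
  then have "RT S A U (\<lambda>i. vl e (rev (xs i)))"
    by (simp add: rev_conv_fold foldl_conv_fold)
  then show ?thesis
    by (rule PT_I[OF _ PT_size[OF assms]]) (simp add: vsize_vl_rev)
qed


text \<open>The argument of a body starts with the argument of the enclosing computation, so
  whatever was computable outside remains computable inside.\<close>

lemma PT_env:
  assumes "\<And>j. j \<in> B \<Longrightarrow> fst j \<in> A" "PT S A U V"
  shows "PT (\<lambda>j. S (fst j)) B (\<lambda>j. Cell (U (fst j)) (X j)) (\<lambda>j. V (fst j))"
  by (rule PT_comp[OF RT_left PT_lift]) (use assms in \<open>auto intro: RT_id\<close>)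

text \<open>Polynomial steps may compose to exponential growth, which is why a bound \<beta> on all
  intermediate accumulators is demanded separately. The step hypothesis hides how the body's
  argument is laid out: it offers only that outer values, accumulator and element are
  computable.\<close>

lemma PT_foldl:
  fixes U :: "'i \<Rightarrow> 'a::field val" and xs :: "'i \<Rightarrow> 'x list" and f :: "'i \<Rightarrow> 'b \<Rightarrow> 'x \<Rightarrow> 'b"
  assumes xs: "PT S A U (\<lambda>i. vl ex (xs i))" and a: "PT S A U (\<lambda>i. eb (a i))"
    and size: "pbd S A \<beta>"
      "\<And>i ys zs. i \<in> A \<Longrightarrow> xs i = ys @ zs \<Longrightarrow> vsize (eb (foldl (f i) (a i) ys)) \<le> \<beta> i"
    and step: "\<And>B (U' :: 'i \<times> 'b \<times> 'x \<Rightarrow> 'a val).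
      (\<And>i b x. (i, b, x) \<in> B \<Longrightarrow> i \<in> A \<and> (\<exists>ys zs. xs i = ys @ x # zs \<and> b = foldl (f i) (a i) ys)) \<Longrightarrow>
      (\<And>V. PT S A U V \<Longrightarrow> PT (\<lambda>j. S (fst j)) B U' (\<lambda>j. V (fst j))) \<Longrightarrow>
      PT (\<lambda>j. S (fst j)) B U' (\<lambda>j. eb (fst (snd j))) \<Longrightarrow>
      PT (\<lambda>j. S (fst j)) B U' (\<lambda>j. ex (snd (snd j))) \<Longrightarrow>
      PT (\<lambda>j. S (fst j)) B U' (\<lambda>j. eb (f (fst j) (fst (snd j)) (snd (snd j))))"
  shows "PT S A U (\<lambda>i. eb (foldl (f i) (a i) (xs i)))"
proof (rule PT_I[OF _ size(1)])
  let ?B = "fold_inst A xs f a"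
  let ?U = "\<lambda>j. Cell (U (fst j)) (Cell (eb (fst (snd j))) (ex (snd (snd j))))"
  have id: "RT (\<lambda>j. S (fst j)) ?B ?U ?U" by (rule RT_id)
  have "PT (\<lambda>j. S (fst j)) ?B ?U (\<lambda>j. eb (f (fst j) (fst (snd j)) (snd (snd j))))"
  proof (rule step)
    show "PT (\<lambda>j. S (fst j)) ?B ?U (\<lambda>j. V (fst j))" if "PT S A U V" for V
      by (rule PT_env[OF _ that]) (auto simp: fold_inst_def)
    show "PT (\<lambda>j. S (fst j)) ?B ?U (\<lambda>j. eb (fst (snd j)))"
      by (rule PT_I[OF RT_left[OF RT_right[OF id]] pbd_lift[OF size(1), where h = fst]])
        (auto simp: fold_inst_def size(2))
    show "PT (\<lambda>j. S (fst j)) ?B ?U (\<lambda>j. ex (snd (snd j)))"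
      by (rule PT_I[OF RT_right[OF RT_right[OF id]] pbd_lift[OF PT_size[OF xs], where h = fst]])
        (auto simp: fold_inst_def intro: vsize_le_vsize_vl)
  qed (auto simp: fold_inst_def)
  then show "RT S A U (\<lambda>i. eb (foldl (f i) (a i) (xs i)))"
    by (intro RT_foldl[where xs = xs and eb = eb and a = a, OF PT_length[OF xs] PT_RT[OF xs] PT_RT[OF a]] PT_RT)
qed (simp add: size(2))

text \<open>The images are computed independently, so the length of the list times the bound for one
  image bounds the result. Consing builds the list backwards, hence the reversal at the end.\<close>

lemma PT_map:
  fixes U :: "'i \<Rightarrow> 'a::field val" and xs :: "'i \<Rightarrow> 'x list"
  assumes xs: "PT S A U (\<lambda>i. vl ex (xs i))"
    and step: "\<And>B (U' :: 'i \<times> 'x \<Rightarrow> 'a val).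
      (\<And>i x. (i, x) \<in> B \<Longrightarrow> i \<in> A \<and> x \<in> set (xs i)) \<Longrightarrow>
      (\<And>V. PT S A U V \<Longrightarrow> PT (\<lambda>j. S (fst j)) B U' (\<lambda>j. V (fst j))) \<Longrightarrow>
      PT (\<lambda>j. S (fst j)) B U' (\<lambda>j. ex (snd j)) \<Longrightarrow>
      PT (\<lambda>j. S (fst j)) B U' (\<lambda>j. ey (h (fst j) (snd j)))"
  shows "PT S A U (\<lambda>i. vl ey (map (h i) (xs i)))"
proof -
  let ?B = "{(i, x). i \<in> A \<and> x \<in> set (xs i)}"
  let ?U = "\<lambda>j. Cell (U (fst j)) (ex (snd j))"
  have id: "RT (\<lambda>j. S (fst j)) ?B ?U ?U" by (rule RT_id)
  have h: "PT (\<lambda>j. S (fst j)) ?B ?U (\<lambda>j. ey (h (fst j) (snd j)))"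
  proof (rule step)
    show "PT (\<lambda>j. S (fst j)) ?B ?U (\<lambda>j. V (fst j))" if "PT S A U V" for V
      by (rule PT_env[OF _ that]) auto
    show "PT (\<lambda>j. S (fst j)) ?B ?U (\<lambda>j. ex (snd j))"
      by (rule PT_I[OF RT_right[OF id] pbd_lift[OF PT_size[OF xs], where h = fst]])
        (auto intro: vsize_le_vsize_vl)
  qed auto
  let ?f = "\<lambda>i acc x. h i x # acc"
  have rev: "foldl (\<lambda>acc x. g x # acc) ys zs = rev (map g zs) @ ys" for g :: "'x \<Rightarrow> 'b" and ys zs
    by (induction zs arbitrary: ys) auto
  obtain a b where q: "\<And>i x. i \<in> A \<Longrightarrow> x \<in> set (xs i) \<Longrightarrow> vsize (ey (h i x)) \<le> a * (S i + 1) ^ b"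
    using PT_size[OF h] unfolding pbd_def by fastforce
  have "PT S A U (\<lambda>i. vl ey (foldl (?f i) [] (xs i)))"
  proof (rule PT_I)
    show "RT S A U (\<lambda>i. vl ey (foldl (?f i) [] (xs i)))"
    proof (rule RT_foldl[OF PT_length[OF xs] PT_RT[OF xs]])
      let ?U' = "\<lambda>j. Cell (U (fst j)) (Cell (vl ey (fst (snd j))) (ex (snd (snd j))))"
      let ?A' = "fold_inst A xs ?f (\<lambda>_. [])"
      have id': "RT (\<lambda>j. S (fst j)) ?A' ?U' ?U'" by (rule RT_id)
      have "RT (\<lambda>j. S (fst j)) ?A' (\<lambda>j. Cell (U (fst j)) (ex (snd (snd j))))
          (\<lambda>j. ey (h (fst j) (snd (snd j))))"
        by (rule RT_lift[OF PT_RT[OF h], where h = "\<lambda>j. (fst j, snd (snd j))", simplified])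
           (auto simp: fold_inst_def)
      from RT_comp[OF RT_pair[OF RT_left[OF id'] RT_right[OF RT_right[OF id']]] this]
      show "RT (\<lambda>j. S (fst j)) ?A' ?U' (\<lambda>j. vl ey (h (fst j) (snd (snd j)) # fst (snd j)))"
        unfolding vl.simps by (rule RT_pair) (rule RT_left[OF RT_right[OF id']])
    qed (simp add: RT_Null)
    show "pbd S A (\<lambda>i. 1 + length (xs i) * (1 + a * (S i + 1) ^ b))"
      by (intro pbd_intros pbd_power pbd_size PT_length[OF xs])
    show "vsize (vl ey (foldl (?f i) [] (xs i))) \<le> 1 + length (xs i) * (1 + a * (S i + 1) ^ b)"
      if "i \<in> A" for i
    proof -
      have "vsize (vl ey (map (h i) (xs i))) \<le> 1 + length (map (h i) (xs i)) * (1 + a * (S i + 1) ^ b)"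
        by (rule vsize_vl_le) (use q[OF that] in auto)
      then show ?thesis unfolding rev append_Nil2 vsize_vl_rev length_map .
    qed
  qed
  from PT_rev[OF this] show ?thesis unfolding rev by simp
qed

lemma PT_append:
  fixes xs :: "'i \<Rightarrow> 'b list"
  assumes xs: "PT S A U (\<lambda>i. vl e (xs i))" and ys: "PT S A U (\<lambda>i. vl e (ys i))"
  shows "PT S A U (\<lambda>i. vl e (xs i @ ys i))"
proof (rule PT_I)
  have "RT S A U (\<lambda>i. vl e (foldl (\<lambda>acc x. x # acc) (ys i) (rev (xs i))))"
  proof (rule RT_foldl[where eb = "vl e" and a = ys,
      OF PT_length[OF PT_rev[OF xs]] PT_RT[OF PT_rev[OF xs]] PT_RT[OF ys]])
    let ?U = "\<lambda>j. Cell (U (fst j)) (Cell (vl e (fst (snd j))) (e (snd (snd j))))"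
    let ?A = "fold_inst A (\<lambda>i. rev (xs i)) (\<lambda>_ acc x. x # acc) ys"
    have id: "RT (\<lambda>j. S (fst j)) ?A ?U ?U" by (rule RT_id)
    show "RT (\<lambda>j. S (fst j)) ?A ?U (\<lambda>j. vl e (snd (snd j) # fst (snd j)))"
      unfolding vl.simps
      by (rule RT_pair[OF RT_right[OF RT_right[OF id]] RT_left[OF RT_right[OF id]]])
  qed
  moreover have "foldl (\<lambda>acc x. x # acc) us (rev vs) = vs @ us" for us vs :: "'b list"
    by (induction vs) auto
  ultimately show "RT S A U (\<lambda>i. vl e (xs i @ ys i))" by simp
  show "pbd S A (\<lambda>i. vsize (vl e (xs i)) + vsize (vl e (ys i)))"
    by (intro pbd_add PT_size[OF xs] PT_size[OF ys])
qed (rule vsize_vl_append_le)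

lemma PT_concat:
  fixes U :: "'i \<Rightarrow> 'a::field val"
  assumes "PT S A U (\<lambda>i. vl (vl e) (xss i))" shows "PT S A U (\<lambda>i. vl e (concat (xss i)))"
proof -
  have foldl: "foldl (@) ys xss = ys @ concat xss" for ys and xss :: "'b list list"
    by (induction xss arbitrary: ys) auto
  have size: "vsize (vl e (concat ys)) \<le> vsize (vl (vl e) (ys @ zs))" for ys zs
    by (induction ys) (use vsize_pos[of "vl (vl e) zs"] in \<open>auto simp: vsize_vl_append Suc_leI\<close>)
  have "PT S A U (\<lambda>i. vl e (foldl (@) [] (xss i)))"
    by (rule PT_foldl[where eb = "vl e", OF assms _ PT_size[OF assms]])
       (auto simp: PT_Null foldl intro: PT_append size)
  then show ?thesis by (simp add: foldl)
qed

lemma PT_filter: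
  fixes U :: "'i \<Rightarrow> 'a::field val" and xs :: "'i \<Rightarrow> 'x list"
  assumes xs: "PT S A U (\<lambda>i. vl e (xs i))"
    and step: "\<And>B (U' :: 'i \<times> 'x \<Rightarrow> 'a val).
      (\<And>i x. (i, x) \<in> B \<Longrightarrow> i \<in> A \<and> x \<in> set (xs i)) \<Longrightarrow>
      (\<And>V. PT S A U V \<Longrightarrow> PT (\<lambda>j. S (fst j)) B U' (\<lambda>j. V (fst j))) \<Longrightarrow>
      PT (\<lambda>j. S (fst j)) B U' (\<lambda>j. e (snd j)) \<Longrightarrow>
      PT (\<lambda>j. S (fst j)) B U' (\<lambda>j. Bit (Q (fst j) (snd j)))"
  shows "PT S A U (\<lambda>i. vl e (filter (Q i) (xs i)))"
proof -
  have "filter R ys = concat (map (\<lambda>x. if R x then [x] else []) ys)" for R :: "'x \<Rightarrow> bool" and ys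
    by (induction ys) auto
  moreover have "PT S A U (\<lambda>i. vl e (concat (map (\<lambda>x. if Q i x then [x] else []) (xs i))))"
  proof (rule PT_concat, rule PT_map[OF xs])
    fix B and U' :: "'i \<times> 'x \<Rightarrow> 'a val"
    assume B: "\<And>i x. (i, x) \<in> B \<Longrightarrow> i \<in> A \<and> x \<in> set (xs i)"
      and lift: "\<And>V. PT S A U V \<Longrightarrow> PT (\<lambda>j. S (fst j)) B U' (\<lambda>j. V (fst j))"
      and x: "PT (\<lambda>j. S (fst j)) B U' (\<lambda>j. e (snd j))"
    show "PT (\<lambda>j. S (fst j)) B U' (\<lambda>j. vl e (if Q (fst j) (snd j) then [snd j] else []))"
      by (rule PT_if'[where e = "vl e", OF step[OF B lift x]]) (simp_all add: PT_Null PT_pair x)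
  qed
  ultimately show ?thesis by simp
qed

lemma PT_list_all:
  fixes U :: "'i \<Rightarrow> 'a::field val" and xs :: "'i \<Rightarrow> 'x list"
  assumes xs: "PT S A U (\<lambda>i. vl e (xs i))"
    and step: "\<And>B (U' :: 'i \<times> 'x \<Rightarrow> 'a val).
      (\<And>i x. (i, x) \<in> B \<Longrightarrow> i \<in> A \<and> x \<in> set (xs i)) \<Longrightarrow>
      (\<And>V. PT S A U V \<Longrightarrow> PT (\<lambda>j. S (fst j)) B U' (\<lambda>j. V (fst j))) \<Longrightarrow>
      PT (\<lambda>j. S (fst j)) B U' (\<lambda>j. e (snd j)) \<Longrightarrow>
      PT (\<lambda>j. S (fst j)) B U' (\<lambda>j. Bit (Q (fst j) (snd j)))"
  shows "PT S A U (\<lambda>i. Bit (list_all (Q i) (xs i)))"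
proof -
  have "PT S A U (\<lambda>i. vl e (filter (\<lambda>x. \<not> Q i x) (xs i)))"
    by (rule PT_filter[OF xs]) (intro PT_not step)
  then have "RT S A U (\<lambda>i. Bit (vl e (filter (\<lambda>x. \<not> Q i x) (xs i)) = Null))"
    by (intro RT_is_Null PT_RT)
  then have "RT S A U (\<lambda>i. Bit (list_all (Q i) (xs i)))"
    by (rule RT_cong) (auto simp: list_all_iff filter_empty_conv)
  then show ?thesis by (rule PT_Bit_I)
qed

text \<open>The list has \<open>x i\<close> entries, exponentially many in the bit length of
  \<open>x i\<close>; hence the polynomial bound on the number itself.\<close>

lemma PT_rev_upt:
  fixes S :: "'i \<Rightarrow> nat" and U :: "'i \<Rightarrow> 'a::field val"
  assumes x: "PT S A U (\<lambda>i. Num (x i))" and bd: "pbd S A x"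
  shows "PT S A U (\<lambda>i. vl Num (rev [0..<x i]))"
proof (rule PT_I)
  define st :: "'i \<Rightarrow> nat \<Rightarrow> 'a val" where
    "st i n = Cell (Bit (n < x i)) (Cell (Num n) (Cell (vl Num (rev [0..<n])) (Num (x i))))" for i n
  let ?A = "{(i, n). i \<in> A \<and> n < x i}"
  let ?W = "\<lambda>j. st (fst j) (snd j)" and ?S = "\<lambda>j :: 'i \<times> nat. S (fst j)"
  have "RT ?S ?A ?W ?W" by (rule RT_id)
  then have W: "RT ?S ?A ?W (\<lambda>j. Cell (Num (snd j)) (Cell (vl Num (rev [0..<snd j])) (Num (x (fst j)))))"
    unfolding st_def by (rule RT_right)
  have "pbd ?S ?A (\<lambda>j. 1 + x (fst j))"
    by (intro pbd_intros pbd_lift[OF bd, where h = fst]) auto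
  then have "PT ?S ?A ?W (\<lambda>j. Num (snd j))"
    by (rule PT_I[OF RT_left[OF W]]) (auto intro: order.trans[OF floorlog_le_self])
  note n = this
  have "PT ?S ?A ?W (\<lambda>j. Num (x (fst j)))"
    by (rule PT_I[OF RT_right[OF RT_right[OF W]] pbd_lift[OF PT_size[OF x], where h = fst]]) auto
  note x' = this
  have m: "PT ?S ?A ?W (\<lambda>j. Num (snd j + 1))"
    by (intro PT_add n PT_Num_const)
  have b: "PT ?S ?A ?W (\<lambda>j. Bit (snd j + 1 < x (fst j)))"
    by (intro PT_less m x')
  have "RT ?S ?A ?W (\<lambda>j. Cell (Bit (snd j + 1 < x (fst j))) (Cell (Num (snd j + 1))
      (Cell (Cell (Num (snd j)) (vl Num (rev [0..<snd j]))) (Num (x (fst j))))))"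
    by (intro RT_pair PT_RT[OF n] PT_RT[OF m] PT_RT[OF b] PT_RT[OF x'] RT_left[OF RT_right[OF W]])
  then have body: "RT ?S ?A ?W (\<lambda>j. st (fst j) (Suc (snd j)))"
    by (rule RT_cong) (simp add: st_def)
  have "RT S A U (\<lambda>i. Cell (Bit (0 < x i)) (Cell (Num 0) (Cell Null (Num (x i)))))"
    by (intro RT_pair PT_RT PT_less PT_Num_const PT_Null x)
  then have "RT S A U (\<lambda>i. st i 0)" by (simp add: st_def)
  moreover have "RT S A (\<lambda>i. st i 0) (\<lambda>i. st i (x i))"
    by (rule RT_loop[OF bd body]) (simp add: st_def)
  ultimately have "RT S A U (\<lambda>i. st i (x i))" by (rule RT_comp)
  then show "RT S A U (\<lambda>i. vl Num (rev [0..<x i]))"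
    unfolding st_def by (elim RT_left[OF RT_right[OF RT_right]])
  show "pbd S A (\<lambda>i. 1 + x i * (1 + (1 + x i)))"
    by (intro pbd_intros bd)
  show "vsize (vl Num (rev [0..<x i])) \<le> 1 + x i * (1 + (1 + x i))" for i
  proof -
    have "vsize (vl Num (rev [0..<x i])) \<le> 1 + length (rev [0..<x i]) * (1 + (1 + x i))"
      by (rule vsize_vl_le) (auto intro: order.trans[OF floorlog_le_self])
    then show ?thesis by simp
  qed
qed

text \<open>The leading digit comes first, which is the order in which square-and-multiply consumes
  the digits.\<close>

definition digits :: "nat \<Rightarrow> nat list" where
  "digits x = map (\<lambda>k. x div 2 ^ k mod 2) (rev [0..<floorlog 2 x])"

lemma digits_0 [simp]: "digits 0 = []"
  by (simp add: digits_def)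

lemma digits_pos: "x > 0 \<Longrightarrow> digits x = digits (x div 2) @ [x mod 2]"
  using compute_floorlog[of 2 x]
  by (simp add: digits_def upt_conv_Cons map_Suc_upt[symmetric] rev_map comp_def div_mult2_eq
      del: upt_Suc)

lemma digits_less: "y \<in> set (digits x) \<Longrightarrow> y < 2"
  by (auto simp: digits_def)

text \<open>The machine cannot read off a bit length. The loop halves the number until it vanishes,
  which takes exactly \<open>floorlog 2 (x i)\<close> passes.\<close>

lemma PT_digits:
  fixes S :: "'i \<Rightarrow> nat" and U :: "'i \<Rightarrow> 'a::field val"
  assumes x: "PT S A U (\<lambda>i. Num (x i))"
  shows "PT S A U (\<lambda>i. vl Num (digits (x i)))"
proof (rule PT_I)
  let ?d = "\<lambda>i n. map (\<lambda>k. x i div 2 ^ k mod 2) (rev [0..<n])"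
  define st :: "'i \<Rightarrow> nat \<Rightarrow> 'a val" where
    "st i n = Cell (Bit (n < floorlog 2 (x i))) (Cell (Num (x i div 2 ^ n)) (vl Num (?d i n)))" for i n
  let ?A = "{(i, n). i \<in> A \<and> n < floorlog 2 (x i)}"
  let ?W = "\<lambda>j. st (fst j) (snd j)" and ?S = "\<lambda>j :: 'i \<times> nat. S (fst j)"
  have pos: "0 < x i div 2 ^ n \<longleftrightarrow> n < floorlog 2 (x i)" for i n
    using floorlog_le_iff[of 2 "x i" n] by (auto simp: div_greater_zero_iff)
  have "RT ?S ?A ?W ?W" by (rule RT_id)
  then have W: "RT ?S ?A ?W (\<lambda>j. Cell (Num (x (fst j) div 2 ^ snd j)) (vl Num (?d (fst j) (snd j))))"
    unfolding st_def by (rule RT_right)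
  have y: "PT ?S ?A ?W (\<lambda>j. Num (x (fst j) div 2 ^ snd j))"
    by (rule PT_I[OF RT_left[OF W] pbd_lift[OF PT_size[OF x], where h = fst]])
       (auto intro: floorlog_mono)
  have z: "PT ?S ?A ?W (\<lambda>j. Num (x (fst j) div 2 ^ snd j div 2))"
    by (intro PT_div y PT_Num_const)
  have "RT ?S ?A ?W (\<lambda>j. Cell (Bit (0 < x (fst j) div 2 ^ snd j div 2))
      (Cell (Num (x (fst j) div 2 ^ snd j div 2))
      (Cell (Num (x (fst j) div 2 ^ snd j mod 2)) (vl Num (?d (fst j) (snd j))))))"
    by (intro RT_pair PT_RT[OF z] PT_RT[OF PT_less] PT_RT[OF PT_mod] z PT_Num_const y RT_right[OF W])
  then have body: "RT ?S ?A ?W (\<lambda>j. st (fst j) (Suc (snd j)))"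
    by (rule RT_cong) (simp add: st_def pos div_mult2_eq[symmetric] mult.commute flip: power_Suc2 power_Suc)
  have "RT S A U (\<lambda>i. Cell (Bit (0 < x i)) (Cell (Num (x i)) Null))"
    by (intro RT_pair PT_RT PT_less PT_Num_const PT_Null x)
  then have "RT S A U (\<lambda>i. st i 0)"
    by (rule RT_cong) (simp add: st_def pos[of _ 0, simplified])
  moreover have "RT S A (\<lambda>i. st i 0) (\<lambda>i. st i (floorlog 2 (x i)))"
    by (rule RT_loop[OF PT_bits[OF x] body]) (simp add: st_def)
  ultimately have "RT S A U (\<lambda>i. st i (floorlog 2 (x i)))" by (rule RT_comp)
  then show "RT S A U (\<lambda>i. vl Num (digits (x i)))"
    unfolding st_def digits_def by (elim RT_right[OF RT_right])
  show "pbd S A (\<lambda>i. 1 + floorlog 2 (x i) * (1 + 2))"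
    by (intro pbd_intros PT_bits[OF x])
  show "vsize (vl Num (digits (x i))) \<le> 1 + floorlog 2 (x i) * (1 + 2)" for i
  proof -
    have "vsize (Num y) \<le> 2" if "y \<in> set (digits (x i))" for y
      using digits_less[OF that] by (auto simp: less_2_cases_iff)
    from vsize_vl_le[of "digits (x i)", OF this] show ?thesis by (simp add: digits_def)
  qed
qed

section \<open>Polynomials as unordered lists of terms\<close>

text \<open>Exponents may be repeated and coefficients may vanish.\<close>

definition poly_of :: "(nat \<times> 'a::field) list \<Rightarrow> 'a poly" where
  "poly_of xs = (\<Sum>t\<leftarrow>xs. monom (snd t) (fst t))"

lemma poly_of_simps [simp]:
  "poly_of [] = 0"
  "poly_of (t # xs) = monom (snd t) (fst t) + poly_of xs"
  "poly_of (xs @ ys) = poly_of xs + poly_of ys"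
  by (auto simp: poly_of_def)

definition lcoeff :: "(nat \<times> 'a::field) list \<Rightarrow> nat \<Rightarrow> 'a" where
  "lcoeff xs e = foldl (\<lambda>s t. if fst t = e then s + snd t else s) 0 xs"

lemma lcoeff [simp]: "lcoeff xs e = coeff (poly_of xs) e"
proof -
  have "foldl (\<lambda>s t. if fst t = e then s + snd t else s) c xs = c + coeff (poly_of xs) e" for c
    by (induction xs arbitrary: c) auto
  then show ?thesis by (simp add: lcoeff_def)
qed

definition lmono :: "nat \<Rightarrow> 'a::field \<Rightarrow> (nat \<times> 'a) list \<Rightarrow> (nat \<times> 'a) list" where
  "lmono k c xs = map (\<lambda>t. (fst t + k, c * snd t)) xs"

lemma poly_of_lmono [simp]: "poly_of (lmono k c xs) = monom c k * poly_of xs"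
  by (induction xs) (auto simp: lmono_def distrib_left mult_monom add.commute)

text \<open>The factor is written \<open>0 - 1\<close> because the machine has only the field
  constants 0 and 1.\<close>

definition lneg :: "(nat \<times> 'a::field) list \<Rightarrow> (nat \<times> 'a) list" where
  "lneg xs = lmono 0 (0 - 1) xs"

lemma poly_of_lneg [simp]: "poly_of (lneg xs) = - poly_of xs"
  by (simp add: lneg_def monom_0)

definition lmul :: "(nat \<times> 'a::field) list \<Rightarrow> (nat \<times> 'a) list \<Rightarrow> (nat \<times> 'a) list" where
  "lmul xs ys = concat (map (\<lambda>t. lmono (fst t) (snd t) ys) xs)"

lemma poly_of_lmul [simp]: "poly_of (lmul xs ys) = poly_of xs * poly_of ys"
  by (induction xs) (auto simp: lmul_def distrib_right)

fun lpow :: "(nat \<times> 'a::field) list \<Rightarrow> nat \<Rightarrow> (nat \<times> 'a) list" where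
  "lpow xs 0 = [(0, 1)]"
| "lpow xs (Suc k) = lmul xs (lpow xs k)"

lemma poly_of_lpow [simp]: "poly_of (lpow xs k) = poly_of xs ^ k"
  by (induction k) auto

text \<open>The sum \<open>x ^ (k - 1) + x ^ (k - 2) * y + ... + y ^ (k - 1)\<close>, which is the
  cofactor of \<open>x - y\<close> in \<open>x ^ k - y ^ k\<close>.\<close>

fun lgeo :: "(nat \<times> 'a::field) list \<Rightarrow> (nat \<times> 'a) list \<Rightarrow> nat \<Rightarrow> (nat \<times> 'a) list" where
  "lgeo xs ys 0 = []"
| "lgeo xs ys (Suc k) = lpow xs k @ lmul ys (lgeo xs ys k)"

lemma poly_of_lgeo:
  "(poly_of xs - poly_of ys) * poly_of (lgeo xs ys k) = poly_of xs ^ k - poly_of ys ^ k"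
proof (induction k)
  case (Suc k)
  have "(poly_of xs - poly_of ys) * poly_of (lgeo xs ys (Suc k)) =
    (poly_of xs - poly_of ys) * poly_of xs ^ k +
    poly_of ys * ((poly_of xs - poly_of ys) * poly_of (lgeo xs ys k))"
    by (simp add: algebra_simps)
  then show ?case unfolding Suc.IH by (simp add: algebra_simps)
qed simp

definition lseg :: "nat \<Rightarrow> nat \<Rightarrow> (nat \<times> 'a::field) list \<Rightarrow> (nat \<times> 'a) list" where
  "lseg lo hi xs = map (\<lambda>t. (fst t - lo, snd t)) (filter (\<lambda>t. lo \<le> fst t \<and> fst t \<le> hi) xs)"

lemma coeff_lseg:
  "coeff (poly_of (lseg lo hi xs)) e = (if e + lo \<le> hi then coeff (poly_of xs) (e + lo) else 0)"
  by (induction xs) (auto simp: lseg_def)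

lemma coeff_filter:
  "coeff (poly_of (filter (\<lambda>t. Q (fst t)) xs)) e = (if Q e then coeff (poly_of xs) e else 0)"
  by (induction xs) auto

text \<open>Terms may cancel, so a nonempty list can represent 0. A nonzero coefficient can only sit
  at a listed exponent, so these are the ones inspected.\<close>

definition lzero :: "(nat \<times> 'a::field) list \<Rightarrow> bool" where
  "lzero xs = list_all (\<lambda>t. lcoeff xs (fst t) = 0) xs"

lemma coeff_poly_of_nonzero: "coeff (poly_of xs) e \<noteq> 0 \<Longrightarrow> e \<in> fst ` set xs"
proof (induction xs)
  case (Cons t xs)
  then show ?case by (cases "fst t = e") auto
qed simp

lemma lzero [simp]: "lzero xs \<longleftrightarrow> poly_of xs = 0"
proof
  assume *: "lzero xs"
  show "poly_of xs = 0"
  proof (rule poly_eqI)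
    fix e show "coeff (poly_of xs) e = coeff 0 e"
      using * coeff_poly_of_nonzero[of xs e] by (auto simp: lzero_def list_all_iff)
  qed
qed (simp add: lzero_def list_all_iff)

text \<open>\<open>k\<close> steps of the long division by a polynomial of degree \<open>d\<close>.\<close>

definition lred :: "(nat \<times> 'a::field) list \<Rightarrow> nat \<Rightarrow> nat \<Rightarrow> (nat \<times> 'a) list \<Rightarrow> (nat \<times> 'a) list" where
  "lred ys d k xs =
    foldl (\<lambda>zs e. zs @ lmono e (0 - lcoeff zs (e + d) / lcoeff ys d) ys) xs (rev [0..<k])"

lemma lred_Suc:
  "lred ys d (Suc k) xs =
    lred ys d k (xs @ lmono k (0 - lcoeff xs (k + d) / lcoeff ys d) ys)"
  by (simp add: lred_def)

lemma lred_dvd: "poly_of ys dvd poly_of (lred ys d k xs) - poly_of xs"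
proof (induction k arbitrary: xs)
  case (Suc k)
  let ?m = "lmono k (0 - lcoeff xs (k + d) / lcoeff ys d) ys"
  have "poly_of ys dvd poly_of (lred ys d k (xs @ ?m)) - poly_of (xs @ ?m)" by (rule Suc)
  moreover have "poly_of ys dvd poly_of ?m" by (simp add: dvd_mult)
  ultimately have "poly_of ys dvd poly_of (lred ys d k (xs @ ?m)) - poly_of (xs @ ?m) + poly_of ?m"
    by (rule dvd_add)
  then show ?case unfolding lred_Suc by simp
qed (simp add: lred_def)

text \<open>The step for exponent \<open>k\<close> cancels the coefficient at \<open>k + d\<close>
  and changes nothing above it, so the range of possible exponents shrinks by one per step.\<close>

lemma coeff_lred:
  assumes "degree (poly_of ys) = d" "poly_of ys \<noteq> 0"
  shows "(\<And>e. e \<ge> d + k \<Longrightarrow> coeff (poly_of xs) e = 0) \<Longrightarrow> e \<ge> d \<Longrightarrow> coeff (poly_of (lred ys d k xs)) e = 0"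
proof (induction k arbitrary: xs)
  case (Suc k)
  have lc: "coeff (poly_of ys) d \<noteq> 0" using assms by auto
  show ?case
    unfolding lred_Suc
  proof (rule Suc.IH[OF _ Suc.prems(2)])
    fix e assume "e \<ge> d + k"
    then consider "e = d + k" | "e \<ge> d + Suc k" by linarith
    then show "coeff (poly_of (xs @ lmono k (0 - lcoeff xs (k + d) / lcoeff ys d) ys)) e = 0"
    proof cases
      case 1
      then show ?thesis using lc by (simp add: coeff_monom_mult add.commute)
    next
      case 2
      then have "coeff (poly_of ys) (e - k) = 0" using assms(1) by (intro coeff_eq_0) auto
      with 2 Suc.prems(1)[of e] show ?thesis by (simp add: coeff_monom_mult)
    qed
  qed
qed (simp add: lred_def)

section \<open>Remainders and powers of \<open>X\<close> modulo a polynomial of small degree\<close>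

definition ltab :: "nat \<Rightarrow> (nat \<times> 'a::field) list \<Rightarrow> (nat \<times> 'a) list" where
  "ltab d xs = map (\<lambda>e. (e, lcoeff xs e)) (rev [0..<d])"

lemma coeff_ltab: "coeff (poly_of (ltab d xs)) e = (if e < d then coeff (poly_of xs) e else 0)"
  by (induction d) (auto simp: ltab_def less_Suc_eq)

text \<open>A product of two remainders times \<open>X\<close> has degree below
  \<open>2 * d\<close>, so \<open>d\<close> division steps suffice. Tabulation then collects
  repeated exponents into exactly \<open>d\<close> terms; otherwise the lists would grow with each
  squaring.\<close>

definition lnf :: "(nat \<times> 'a::field) list \<Rightarrow> nat \<Rightarrow> (nat \<times> 'a) list \<Rightarrow> (nat \<times> 'a) list" where
  "lnf ys d xs = ltab d (lred ys d d xs)"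

lemma coeff_lnf: "e \<ge> d \<Longrightarrow> coeff (poly_of (lnf ys d xs)) e = 0"
  by (simp add: lnf_def coeff_ltab)

text \<open>For \<open>d = 0\<close> the degree condition would force \<open>xs\<close> to represent
  0. That case is allowed separately: \<open>ys\<close> is then a nonzero constant and divides
  everything.\<close>

lemma lnf_dvd:
  assumes "degree (poly_of ys) = d" "poly_of ys \<noteq> 0"
    and "d = 0 \<or> (\<forall>e \<ge> d + d. coeff (poly_of xs) e = 0)"
  shows "poly_of ys dvd poly_of (lnf ys d xs) - poly_of xs"
proof (cases "d = 0")
  case True
  then have "is_unit (poly_of ys)" using assms(1,2) by (simp add: is_unit_iff_degree)
  then show ?thesis by (rule unit_imp_dvd)
next
  case False
  then have "poly_of (lnf ys d xs) = poly_of (lred ys d d xs)"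
    using assms coeff_lred[OF assms(1,2), of d xs]
    by (intro poly_eqI) (auto simp: lnf_def coeff_ltab)
  then show ?thesis by (simp add: lred_dvd)
qed

text \<open>Square-and-multiply: the accumulator is congruent to \<open>X\<close> raised to the
  number read so far. The initial 1 is reduced too, since it is not a remainder when
  \<open>d = 0\<close>.\<close>

definition lxpow :: "(nat \<times> 'a::field) list \<Rightarrow> nat \<Rightarrow> nat \<Rightarrow> (nat \<times> 'a) list" where
  "lxpow ys d e =
    foldl (\<lambda>r b. lnf ys d (lmono b 1 (lmul r r))) (lnf ys d [(0, 1)]) (digits e)"

lemma coeff_lxpow: "k \<ge> d \<Longrightarrow> coeff (poly_of (lxpow ys d e)) k = 0"
  by (cases "digits e" rule: rev_cases) (simp_all add: lxpow_def coeff_lnf)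

lemma lxpow_dvd:
  assumes "degree (poly_of ys) = d" "poly_of ys \<noteq> 0"
  shows "poly_of ys dvd poly_of (lxpow ys d e) - monom 1 e"
proof (induction e rule: less_induct)
  case (less e)
  show ?case
  proof (cases "e = 0")
    case True
    have "poly_of ys dvd poly_of (lnf ys d [(0, 1)]) - poly_of [(0, 1)]"
      by (rule lnf_dvd[OF assms]) auto
    then show ?thesis using True by (simp add: lxpow_def)
  next
    case False
    let ?r = "lxpow ys d (e div 2)" and ?m = "monom 1 (e div 2) :: 'a poly"
    let ?s = "lmono (e mod 2) 1 (lmul ?r ?r)"
    have "poly_of ys dvd poly_of (lnf ys d ?s) - poly_of ?s"
    proof (rule lnf_dvd[OF assms])
      have "coeff (poly_of ?s) k = 0" if "d \<noteq> 0" "k \<ge> d + d" for k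
      proof -
        have "degree (poly_of ?r) \<le> d - 1"
          using that by (intro degree_le) (auto intro: coeff_lxpow)
        \<comment> \<open>Together with the shift by one binary digit the degree is at most
          \<open>2 * (d - 1) + 1\<close>, just below \<open>d + d\<close>.\<close>
        then have "degree (poly_of ?r * poly_of ?r) \<le> (d - 1) + (d - 1)"
          by (meson add_mono degree_mult_le order_trans)
        then have "coeff (poly_of ?r * poly_of ?r) (k - e mod 2) = 0"
          using that by (intro coeff_eq_0) (cases "e mod 2 = 0"; simp)
        then show ?thesis by (simp add: coeff_monom_mult)
      qed
      then show "d = 0 \<or> (\<forall>e\<ge>d + d. coeff (poly_of ?s) e = 0)" by blast
    qed
    moreover have "poly_of ys dvd poly_of ?s - monom 1 e"
    proof -
      have "monom 1 e = monom 1 (e mod 2) * (?m * ?m)"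
        by (simp add: mult_monom) (metis add.assoc mod_mult_div_eq mult_2 add.commute)
      \<comment> \<open>A difference of squares; its last factor is divisible by induction.\<close>
      then have "poly_of ?s - monom 1 e =
          monom 1 (e mod 2) * (poly_of ?r + ?m) * (poly_of ?r - ?m)"
        by (simp add: algebra_simps)
      then show ?thesis using less[of "e div 2"] False by (simp add: dvd_mult)
    qed
    moreover have "lxpow ys d e = lnf ys d ?s"
      using False by (simp add: lxpow_def digits_pos)
    ultimately show ?thesis
      using dvd_add[of "poly_of ys" "poly_of (lnf ys d ?s) - poly_of ?s" "poly_of ?s - monom 1 e"]
      by (simp del: poly_of_lmono)
  qed
qed

definition lmod :: "(nat \<times> 'a::field) list \<Rightarrow> nat \<Rightarrow> (nat \<times> 'a) list \<Rightarrow> (nat \<times> 'a) list" where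
  "lmod ys d xs = concat (map (\<lambda>t. lmono 0 (snd t) (lxpow ys d (fst t))) xs)"

text \<open>Replacing each power of \<open>X\<close> by its remainder preserves the class modulo
  \<open>ys\<close> and leaves degree below \<open>d\<close>, where 0 is the only multiple of
  \<open>ys\<close>.\<close>

lemma dvd_iff_lmod:
  assumes "degree (poly_of ys) = d" "poly_of ys \<noteq> 0"
  shows "poly_of ys dvd poly_of xs \<longleftrightarrow> poly_of (lmod ys d xs) = 0"
proof -
  have "poly_of ys dvd poly_of (lmod ys d xs) - poly_of xs"
  proof (induction xs)
    case (Cons t xs)
    have "poly_of ys dvd [:snd t:] * (poly_of (lxpow ys d (fst t)) - monom 1 (fst t)) +
        (poly_of (lmod ys d xs) - poly_of xs)"
      by (intro dvd_add dvd_mult lxpow_dvd assms Cons)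
    then show ?case by (simp add: lmod_def algebra_simps monom_0 smult_monom)
  qed (simp add: lmod_def)
  then have "poly_of ys dvd poly_of xs \<longleftrightarrow> poly_of ys dvd poly_of (lmod ys d xs)"
    by (metis dvd_diff_left_iff dvd_diff_right_iff)
  also have "\<dots> \<longleftrightarrow> poly_of (lmod ys d xs) = 0"
  proof
    assume *: "poly_of ys dvd poly_of (lmod ys d xs)"
    have "coeff (poly_of (lmod ys d xs)) e = 0" if "e \<ge> d" for e
      using that by (induction xs) (auto simp: lmod_def coeff_lxpow coeff_monom_mult)
    with * show "poly_of (lmod ys d xs) = 0"
      using assms by (metis dvd_imp_degree_le leading_coeff_0_iff)
  qed simp
  finally show ?thesis .
qed

section \<open>Cost of the operations on lists of terms\<close>

definition term_val :: "nat \<times> 'a \<Rightarrow> 'a val" where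
  "term_val t = Cell (Num (fst t)) (Elt (snd t))"

abbreviation poly_val :: "(nat \<times> 'a) list \<Rightarrow> 'a val" where
  "poly_val \<equiv> vl term_val"

lemma encode_eq: "encode xs = poly_val xs"
  by (induction xs rule: encode.induct) (auto simp: term_val_def)

lemma vsize_term_val: "vsize (term_val t) = 3 + floorlog 2 (fst t)"
  by (simp add: term_val_def)

lemma PT_term:
  "PT S A U (\<lambda>i. Num (e i)) \<Longrightarrow> PT S A U (\<lambda>i. Elt (c i)) \<Longrightarrow> PT S A U (\<lambda>i. term_val (e i, c i))"
  unfolding term_val_def fst_conv snd_conv by (rule PT_pair)

lemma PT_exponent: "PT S A U (\<lambda>i. term_val (t i)) \<Longrightarrow> PT S A U (\<lambda>i. Num (fst (t i)))"
  and PT_coeff: "PT S A U (\<lambda>i. term_val (t i)) \<Longrightarrow> PT S A U (\<lambda>i. Elt (snd (t i)))"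
  unfolding term_val_def by (erule PT_left, erule PT_right)

lemma PT_lcoeff:
  fixes S :: "'i \<Rightarrow> nat" and U :: "'i \<Rightarrow> 'a::field val"
  assumes xs: "PT S A U (\<lambda>i. poly_val (xs i))" and e: "PT S A U (\<lambda>i. Num (e i))"
  shows "PT S A U (\<lambda>i. Elt (lcoeff (xs i) (e i)))"
  unfolding lcoeff_def
proof (rule PT_foldl[where eb = Elt and a = "\<lambda>_. 0", OF xs PT_Elt0 pbd_const[of _ _ 1]])
  fix B and U' :: "'i \<times> 'a \<times> nat \<times> 'a \<Rightarrow> 'a val"
  assume lift: "\<And>V. PT S A U V \<Longrightarrow> PT (\<lambda>j. S (fst j)) B U' (\<lambda>j. V (fst j))"
    and s: "PT (\<lambda>j. S (fst j)) B U' (\<lambda>j. Elt (fst (snd j)))"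
    and t: "PT (\<lambda>j. S (fst j)) B U' (\<lambda>j. term_val (snd (snd j)))"
  show "PT (\<lambda>j. S (fst j)) B U' (\<lambda>j. Elt (if fst (snd (snd j)) = e (fst j)
      then fst (snd j) + snd (snd (snd j)) else fst (snd j)))"
    by (intro PT_if'[where e = Elt] PT_eq PT_Elt_add s PT_exponent[OF t] PT_coeff[OF t] lift[OF e])
qed simp

lemma PT_lmono:
  fixes S :: "'i \<Rightarrow> nat" and U :: "'i \<Rightarrow> 'a::field val"
  assumes k: "PT S A U (\<lambda>i. Num (k i))" and c: "PT S A U (\<lambda>i. Elt (c i))"
    and xs: "PT S A U (\<lambda>i. poly_val (xs i))"
  shows "PT S A U (\<lambda>i. poly_val (lmono (k i) (c i) (xs i)))"
  unfolding lmono_def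
proof (rule PT_map[OF xs])
  fix B and U' :: "'i \<times> nat \<times> 'a \<Rightarrow> 'a val"
  assume lift: "\<And>V. PT S A U V \<Longrightarrow> PT (\<lambda>j. S (fst j)) B U' (\<lambda>j. V (fst j))"
    and t: "PT (\<lambda>j. S (fst j)) B U' (\<lambda>j. term_val (snd j))"
  show "PT (\<lambda>j. S (fst j)) B U' (\<lambda>j. term_val (fst (snd j) + k (fst j), c (fst j) * snd (snd j)))"
    by (intro PT_term PT_add PT_Elt_mult PT_exponent[OF t] PT_coeff[OF t] lift[OF k] lift[OF c])
qed

lemma PT_lneg: "PT S A U (\<lambda>i. poly_val (xs i)) \<Longrightarrow> PT S A U (\<lambda>i. poly_val (lneg (xs i)))"
  unfolding lneg_def by (intro PT_lmono PT_Num_const PT_Elt_sub PT_Elt0 PT_Elt1)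

lemma PT_lzero:
  fixes S :: "'i \<Rightarrow> nat" and U :: "'i \<Rightarrow> 'a::field val"
  assumes xs: "PT S A U (\<lambda>i. poly_val (xs i))"
  shows "PT S A U (\<lambda>i. Bit (lzero (xs i)))"
  unfolding lzero_def
proof (rule PT_list_all[OF xs])
  fix B and U' :: "'i \<times> nat \<times> 'a \<Rightarrow> 'a val"
  assume lift: "\<And>V. PT S A U V \<Longrightarrow> PT (\<lambda>j. S (fst j)) B U' (\<lambda>j. V (fst j))"
    and t: "PT (\<lambda>j. S (fst j)) B U' (\<lambda>j. term_val (snd j))"
  show "PT (\<lambda>j. S (fst j)) B U' (\<lambda>j. Bit (lcoeff (xs (fst j)) (fst (snd j)) = 0))"
    by (intro PT_is_zero PT_lcoeff PT_exponent[OF t] lift[OF xs])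
qed

lemma PT_lseg:
  fixes S :: "'i \<Rightarrow> nat" and U :: "'i \<Rightarrow> 'a::field val"
  assumes lo: "PT S A U (\<lambda>i. Num (lo i))" and hi: "PT S A U (\<lambda>i. Num (hi i))"
    and xs: "PT S A U (\<lambda>i. poly_val (xs i))"
  shows "PT S A U (\<lambda>i. poly_val (lseg (lo i) (hi i) (xs i)))"
proof -
  have "PT S A U (\<lambda>i. poly_val (filter (\<lambda>t. lo i \<le> fst t \<and> fst t \<le> hi i) (xs i)))"
  proof (rule PT_filter[OF xs])
    fix B and U' :: "'i \<times> nat \<times> 'a \<Rightarrow> 'a val"
    assume lift: "\<And>V. PT S A U V \<Longrightarrow> PT (\<lambda>j. S (fst j)) B U' (\<lambda>j. V (fst j))"
      and t: "PT (\<lambda>j. S (fst j)) B U' (\<lambda>j. term_val (snd j))"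
    show "PT (\<lambda>j. S (fst j)) B U' (\<lambda>j. Bit (lo (fst j) \<le> fst (snd j) \<and> fst (snd j) \<le> hi (fst j)))"
      by (intro PT_conj PT_le PT_exponent[OF t] lift[OF lo] lift[OF hi])
  qed
  then show ?thesis
    unfolding lseg_def
  proof (rule PT_map)
    fix B and U' :: "'i \<times> nat \<times> 'a \<Rightarrow> 'a val"
    assume lift: "\<And>V. PT S A U V \<Longrightarrow> PT (\<lambda>j. S (fst j)) B U' (\<lambda>j. V (fst j))"
      and t: "PT (\<lambda>j. S (fst j)) B U' (\<lambda>j. term_val (snd j))"
    show "PT (\<lambda>j. S (fst j)) B U' (\<lambda>j. term_val (fst (snd j) - lo (fst j), snd (snd j)))"
      by (intro PT_term PT_sub PT_exponent[OF t] PT_coeff[OF t] lift[OF lo])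
  qed
qed

lemma PT_ltab:
  fixes S :: "'i \<Rightarrow> nat" and U :: "'i \<Rightarrow> 'a::field val"
  assumes d: "PT S A U (\<lambda>i. Num (d i))" "pbd S A d" and xs: "PT S A U (\<lambda>i. poly_val (xs i))"
  shows "PT S A U (\<lambda>i. poly_val (ltab (d i) (xs i)))"
  unfolding ltab_def
proof (rule PT_map[OF PT_rev_upt[OF d]])
  fix B and U' :: "'i \<times> nat \<Rightarrow> 'a val"
  assume lift: "\<And>V. PT S A U V \<Longrightarrow> PT (\<lambda>j. S (fst j)) B U' (\<lambda>j. V (fst j))"
    and e: "PT (\<lambda>j. S (fst j)) B U' (\<lambda>j. Num (snd j))"
  show "PT (\<lambda>j. S (fst j)) B U' (\<lambda>j. term_val (snd j, lcoeff (xs (fst j)) (snd j)))"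
    by (intro PT_term PT_lcoeff e lift[OF xs])
qed

lemma PT_lmul:
  fixes S :: "'i \<Rightarrow> nat" and U :: "'i \<Rightarrow> 'a::field val"
  assumes xs: "PT S A U (\<lambda>i. poly_val (xs i))" and ys: "PT S A U (\<lambda>i. poly_val (ys i))"
  shows "PT S A U (\<lambda>i. poly_val (lmul (xs i) (ys i)))"
  unfolding lmul_def
proof (rule PT_concat, rule PT_map[OF xs])
  fix B and U' :: "'i \<times> nat \<times> 'a \<Rightarrow> 'a val"
  assume lift: "\<And>V. PT S A U V \<Longrightarrow> PT (\<lambda>j. S (fst j)) B U' (\<lambda>j. V (fst j))"
    and t: "PT (\<lambda>j. S (fst j)) B U' (\<lambda>j. term_val (snd j))"
  show "PT (\<lambda>j. S (fst j)) B U' (\<lambda>j. poly_val (lmono (fst (snd j)) (snd (snd j)) (ys (fst j))))"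
    by (intro PT_lmono PT_exponent[OF t] PT_coeff[OF t] lift[OF ys])
qed

lemma PT_one: "PT S A U (\<lambda>_. poly_val [(0, 1)])"
  unfolding vl.simps by (intro PT_pair PT_term PT_Num_const PT_Elt1 PT_Null)

text \<open>The exponent \<open>k\<close> is the same for all instances, so the multiplications are
  unrolled into the program, and the \<open>k\<close>-th power of the number of terms is still
  polynomial.\<close>

lemma PT_lpow:
  assumes "PT S A U (\<lambda>i. poly_val (xs i))"
  shows "PT S A U (\<lambda>i. poly_val (lpow (xs i) k))"
proof (induction k)
  case 0
  show ?case unfolding lpow.simps by (rule PT_one)
next
  case (Suc k)
  then show ?case unfolding lpow.simps by (intro PT_lmul assms)
qed

lemma PT_lgeo:
  assumes "PT S A U (\<lambda>i. poly_val (xs i))" "PT S A U (\<lambda>i. poly_val (ys i))"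
  shows "PT S A U (\<lambda>i. poly_val (lgeo (xs i) (ys i) k))"
proof (induction k)
  case 0
  show ?case by (simp add: PT_Null)
next
  case (Suc k)
  then show ?case unfolding lgeo.simps by (intro PT_append PT_lpow PT_lmul assms)
qed

lemma vsize_lmono_le: "vsize (poly_val (lmono k c xs)) \<le> vsize (poly_val xs) + length xs * (1 + k)"
proof (induction xs)
  case (Cons t xs)
  have "floorlog 2 (fst t + k) \<le> 1 + floorlog 2 (fst t) + k"
    using floorlog_add_le[of "fst t" k] floorlog_le_self[of k] by linarith
  with Cons show ?case by (simp add: lmono_def vsize_term_val)
qed (simp add: lmono_def)

text \<open>Every step appends one shifted copy of \<open>ys\<close>, so the accumulator grows
  additively. With polynomially many steps the crude bound by the shift instead of its bit length is
  good enough.\<close>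

lemma PT_lred:
  fixes S :: "'i \<Rightarrow> nat" and U :: "'i \<Rightarrow> 'a::field val"
  assumes ys: "PT S A U (\<lambda>i. poly_val (ys i))" and d: "PT S A U (\<lambda>i. Num (d i))"
    and k: "PT S A U (\<lambda>i. Num (k i))" "pbd S A k" and xs: "PT S A U (\<lambda>i. poly_val (xs i))"
  shows "PT S A U (\<lambda>i. poly_val (lred (ys i) (d i) (k i) (xs i)))"
  unfolding lred_def
proof (rule PT_foldl[where eb = poly_val and a = xs, OF PT_rev_upt[OF k] xs])
  show "pbd S A (\<lambda>i. vsize (poly_val (xs i)) +
      k i * (vsize (poly_val (ys i)) + length (ys i) * (1 + k i)))"
    by (intro pbd_intros k(2) PT_size[OF xs] PT_size[OF ys] PT_length[OF ys])
next
  fix i es fs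
  assume i: "i \<in> A" "rev [0..<k i] = es @ fs"
  let ?q = "vsize (poly_val (ys i)) + length (ys i) * (1 + k i)"
  let ?f = "\<lambda>zs e. zs @ lmono e (0 - lcoeff zs (e + d i) / lcoeff (ys i) (d i)) (ys i)"
  have le: "e \<le> k i" if "e \<in> set es" for e
  proof -
    have "e \<in> set (rev [0..<k i])" using that unfolding i(2) by simp
    then show ?thesis by simp
  qed
  have "vsize (poly_val (foldl ?f zs es)) \<le> vsize (poly_val zs) + length es * ?q" for zs
    using le
  proof (induction es arbitrary: zs)
    case (Cons e es)
    let ?m = "lmono e (0 - lcoeff zs (e + d i) / lcoeff (ys i) (d i)) (ys i)"
    have "vsize (poly_val ?m) \<le> vsize (poly_val (ys i)) + length (ys i) * (1 + e)"
      by (rule vsize_lmono_le)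
    also have "\<dots> \<le> ?q" using Cons.prems[of e] by simp
    finally have "vsize (poly_val (zs @ ?m)) \<le> vsize (poly_val zs) + ?q"
      using vsize_vl_append_le[of term_val zs ?m] by linarith
    moreover have "vsize (poly_val (foldl ?f (zs @ ?m) es)) \<le> vsize (poly_val (zs @ ?m)) + length es * ?q"
      using Cons by simp
    ultimately show ?case by simp
  qed simp
  note this[of "xs i"]
  also have "length es * ?q \<le> k i * ?q"
    using arg_cong[OF i(2), of length] by (intro mult_le_mono1) simp
  finally show "vsize (poly_val (foldl ?f (xs i) es)) \<le> vsize (poly_val (xs i)) + k i * ?q"
    by simp
next
  fix B and U' :: "'i \<times> (nat \<times> 'a) list \<times> nat \<Rightarrow> 'a val"
  assume lift: "\<And>V. PT S A U V \<Longrightarrow> PT (\<lambda>j. S (fst j)) B U' (\<lambda>j. V (fst j))"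
    and zs: "PT (\<lambda>j. S (fst j)) B U' (\<lambda>j. poly_val (fst (snd j)))"
    and e: "PT (\<lambda>j. S (fst j)) B U' (\<lambda>j. Num (snd (snd j)))"
  show "PT (\<lambda>j. S (fst j)) B U' (\<lambda>j. poly_val (fst (snd j) @ lmono (snd (snd j))
      (0 - lcoeff (fst (snd j)) (snd (snd j) + d (fst j)) / lcoeff (ys (fst j)) (d (fst j)))
      (ys (fst j))))"
    by (intro PT_append PT_lmono PT_Elt_sub PT_Elt_div PT_Elt0 PT_lcoeff PT_add zs e lift[OF d] lift[OF ys])
qed

lemma PT_lnf:
  assumes "PT S A U (\<lambda>i. poly_val (ys i))" "PT S A U (\<lambda>i. Num (d i))" "pbd S A d"
    "PT S A U (\<lambda>i. poly_val (xs i))"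
  shows "PT S A U (\<lambda>i. poly_val (lnf (ys i) (d i) (xs i)))"
  unfolding lnf_def by (intro PT_ltab PT_lred assms)

text \<open>The bound does not involve \<open>xs\<close>. This is what keeps the accumulators of
  repeated squaring small.\<close>

lemma vsize_lnf_le: "vsize (poly_val (lnf ys d xs)) \<le> 1 + d * (1 + (3 + d))"
proof -
  have "vsize (poly_val (lnf ys d xs)) \<le> 1 + length (lnf ys d xs) * (1 + (3 + d))"
    by (rule vsize_vl_le)
       (auto simp: lnf_def ltab_def vsize_term_val intro: order.trans[OF floorlog_le_self])
  then show ?thesis by (simp add: lnf_def ltab_def)
qed

lemma PT_lxpow:
  fixes S :: "'i \<Rightarrow> nat" and U :: "'i \<Rightarrow> 'a::field val"
  assumes ys: "PT S A U (\<lambda>i. poly_val (ys i))" and d: "PT S A U (\<lambda>i. Num (d i))" "pbd S A d"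
    and e: "PT S A U (\<lambda>i. Num (e i))"
  shows "PT S A U (\<lambda>i. poly_val (lxpow (ys i) (d i) (e i)))"
  unfolding lxpow_def
proof (rule PT_foldl[where eb = poly_val and a = "\<lambda>i. lnf (ys i) (d i) [(0, 1)]",
      OF PT_digits[OF e] PT_lnf[OF ys d PT_one]])
  show "pbd S A (\<lambda>i. 1 + d i * (1 + (3 + d i)))"
    by (intro pbd_intros d)
next
  fix i bs
  show "vsize (poly_val (foldl (\<lambda>r b. lnf (ys i) (d i) (lmono b 1 (lmul r r)))
      (lnf (ys i) (d i) [(0, 1)]) bs)) \<le> 1 + d i * (1 + (3 + d i))"
    by (cases bs rule: rev_cases) (simp_all only: foldl.simps foldl_append vsize_lnf_le)
next
  fix B and U' :: "'i \<times> (nat \<times> 'a) list \<times> nat \<Rightarrow> 'a val"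
  assume B: "\<And>i r b. (i, r, b) \<in> B \<Longrightarrow> i \<in> A \<and> (\<exists>xs zs. digits (e i) = xs @ b # zs \<and>
      r = foldl (\<lambda>r b. lnf (ys i) (d i) (lmono b 1 (lmul r r))) (lnf (ys i) (d i) [(0, 1)]) xs)"
    and lift: "\<And>V. PT S A U V \<Longrightarrow> PT (\<lambda>j. S (fst j)) B U' (\<lambda>j. V (fst j))"
    and r: "PT (\<lambda>j. S (fst j)) B U' (\<lambda>j. poly_val (fst (snd j)))"
    and b: "PT (\<lambda>j. S (fst j)) B U' (\<lambda>j. Num (snd (snd j)))"
  have "pbd (\<lambda>j. S (fst j)) B (\<lambda>j. d (fst j))"
    by (rule pbd_lift[OF d(2)]) (use B in auto)
  then show "PT (\<lambda>j. S (fst j)) B U' (\<lambda>j. poly_val (lnf (ys (fst j)) (d (fst j))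
      (lmono (snd (snd j)) 1 (lmul (fst (snd j)) (fst (snd j))))))"
    by (intro PT_lnf PT_lmono PT_lmul PT_Elt1 r b lift[OF ys] lift[OF d(1)])
qed

lemma PT_lmod:
  fixes S :: "'i \<Rightarrow> nat" and U :: "'i \<Rightarrow> 'a::field val"
  assumes ys: "PT S A U (\<lambda>i. poly_val (ys i))" and d: "PT S A U (\<lambda>i. Num (d i))" "pbd S A d"
    and xs: "PT S A U (\<lambda>i. poly_val (xs i))"
  shows "PT S A U (\<lambda>i. poly_val (lmod (ys i) (d i) (xs i)))"
  unfolding lmod_def
proof (rule PT_concat, rule PT_map[OF xs])
  fix B and U' :: "'i \<times> nat \<times> 'a \<Rightarrow> 'a val"
  assume B: "\<And>i t. (i, t) \<in> B \<Longrightarrow> i \<in> A \<and> t \<in> set (xs i)"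
    and lift: "\<And>V. PT S A U V \<Longrightarrow> PT (\<lambda>j. S (fst j)) B U' (\<lambda>j. V (fst j))"
    and t: "PT (\<lambda>j. S (fst j)) B U' (\<lambda>j. term_val (snd j))"
  have "pbd (\<lambda>j. S (fst j)) B (\<lambda>j. d (fst j))"
    by (rule pbd_lift[OF d(2)]) (use B in auto)
  then show "PT (\<lambda>j. S (fst j)) B U' (\<lambda>j. poly_val (lmono 0 (snd (snd j))
      (lxpow (ys (fst j)) (d (fst j)) (fst (snd j)))))"
    by (intro PT_lmono PT_lxpow PT_Num_const PT_exponent[OF t] PT_coeff[OF t] lift[OF ys] lift[OF d(1)])
qed

section \<open>Divisibility from a window of the cofactor product\<close>

lemma monom_1_dvd_monom_1: "k \<le> l \<Longrightarrow> monom 1 k dvd (monom 1 l :: 'a::field poly)"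
  by (metis dvd_triv_left le_add_diff_inverse mult_1 mult_monom)

lemma monom_1_dvd_power:
  "monom 1 k dvd (p :: 'a::field poly) \<Longrightarrow> monom 1 (k * l) dvd p ^ l"
  using dvd_power_same[of "monom 1 k" p l] by (simp add: monom_power)

text \<open>From \<open>n <= q * g\<close> follows \<open>2 * n <= r * g\<close>. One
  \<open>n\<close> is kept for the spread caused by \<open>Q\<close>; the other covers
  \<open>r * r * d = 4 * q * q * d\<close>, which the threshold keeps at most
  \<open>n\<close>.\<close>

lemma window_bound:
  assumes "r = 2 * q" "q \<ge> (1::nat)" "n \<le> q * g" "8 * q ^ 3 * d \<le> n"
  shows "r * r * d + n \<le> r * g"
proof -
  have "q * q * d * 1 \<le> q * q * d * (2 * q)"
    using assms(2) by (intro mult_le_mono2) simp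
  also have "4 * (q * q * d * (2 * q)) \<le> n"
    using assms(4) by (simp add: power3_eq_cube ac_simps)
  finally show ?thesis using assms(1,3) by simp
qed

text \<open>All monomials of \<open>E ^ r\<close> other than \<open>V ^ (r * r)\<close> contain \<open>W ^ r\<close>, and all monomials of
  \<open>C ^ r\<close> contain \<open>U ^ r\<close>. Hence both gaps around \<open>V ^ (r * r)\<close> have length at least \<open>n\<close>.\<close>

lemma window:
  fixes U V W G\<^sub>1 Q :: "'a::field poly"
  assumes A: "A = U + V" and V: "V = monom 1 i * G\<^sub>1" and deg: "degree G\<^sub>1 \<le> d" "degree Q < n"
    and W: "monom 1 (i + d + g) dvd W" and U: "U = 0 \<or> degree U + g \<le> i"
    and E: "E = V ^ r - W ^ r" and C: "C = V ^ r - A ^ r"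
    and r: "r = 2 * q" "q \<ge> 1" and n: "n \<le> q * g" "8 * q ^ 3 * d \<le> n"
  obtains H L where
    "(E ^ r - C ^ r) * Q =
      monom 1 (r * r * i) * (G\<^sub>1 ^ (r * r) * Q) + monom 1 (r * r * i + r * r * d + n) * H + L"
    "\<And>e. e \<ge> r * r * i \<Longrightarrow> coeff L e = 0"
proof -
  have bound: "r * r * d + n \<le> r * g" by (rule window_bound[OF r n])
  obtain r' where r': "r = Suc r'" using r by (metis Suc_pred' gr0I mult_is_0 not_one_le_zero zero_neq_numeral)
  have Vr: "monom 1 (i * r) dvd V ^ r"
    by (rule monom_1_dvd_power) (simp add: V)
  have Wr: "monom 1 ((i + d + g) * r) dvd W ^ r"
    by (rule monom_1_dvd_power[OF W])
  have "monom 1 (i * r) dvd W ^ r"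
    by (rule dvd_trans[OF monom_1_dvd_monom_1 Wr]) simp
  then have Er: "monom 1 (i * r) dvd E"
    unfolding E by (rule dvd_diff[OF Vr])
  \<comment> \<open>The difference \<open>E ^ r - (V ^ r) ^ r\<close> is \<open>- (W ^ r)\<close>
    times this sum, whose summands are products of \<open>r' = r - 1\<close> factors, each divisible
    by \<open>X ^ (i * r)\<close>.\<close>
  have "monom 1 (i * r * r') dvd (\<Sum>k<r. (V ^ r) ^ (r - Suc k) * E ^ k)"
  proof (rule dvd_sum)
    fix k assume "k \<in> {..<r}"
    then have "i * r * (r - Suc k) + i * r * k = i * r * r'"
      unfolding r' by (simp flip: distrib_left)
    with mult_dvd_mono[OF monom_1_dvd_power[OF Vr, of "r - Suc k"] monom_1_dvd_power[OF Er, of k]]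
    show "monom 1 (i * r * r') dvd (V ^ r) ^ (r - Suc k) * E ^ k"
      by (simp add: mult_monom)
  qed
  with Wr have "monom 1 ((i + d + g) * r) * monom 1 (i * r * r') dvd
      - (W ^ r) * (\<Sum>k<r. (V ^ r) ^ (r - Suc k) * E ^ k)"
    by (intro mult_dvd_mono) auto
  also have "- (W ^ r) * (\<Sum>k<r. (V ^ r) ^ (r - Suc k) * E ^ k) = E ^ r - (V ^ r) ^ r"
    unfolding power_diff_sumr2 by (simp add: E)
  finally have dvd: "monom 1 ((i + d + g) * r + i * r * r') dvd E ^ r - (V ^ r) ^ r"
    by (simp add: mult_monom)
  \<comment> \<open>The right side equals \<open>r * r * i + r * (d + g)\<close>, where
    \<open>r * g\<close> already covers \<open>r * r * d + n\<close>.\<close>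
  have "r * r * i + r * r * d + n \<le> (i + d + g) * r + i * r * r'"
    using bound by (simp add: r' algebra_simps)
  then have "monom 1 (r * r * i + r * r * d + n) dvd E ^ r - (V ^ r) ^ r"
    by (rule dvd_trans[OF monom_1_dvd_monom_1 dvd])
  then obtain H where H: "E ^ r - (V ^ r) ^ r = monom 1 (r * r * i + r * r * d + n) * H" ..
  \<comment> \<open>This product serves as the lower part \<open>L\<close>. If \<open>U = 0\<close>,
    then \<open>A = V\<close> and \<open>C = 0\<close>.\<close>
  have L: "coeff (- (C ^ r * Q)) e = 0" if e: "e \<ge> r * r * i" for e
  proof (cases "U = 0")
    case True
    then show ?thesis unfolding C A r' by simp
  next
    case False
    then have u: "degree U + g \<le> i" using U by simp
    have dV: "degree V \<le> i + d"
      unfolding V using deg(1) degree_mult_le[of "monom 1 i" G\<^sub>1] degree_monom_le[of "1::'a" i] by linarith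
    then have dA: "degree A \<le> i + d"
      unfolding A using u by (intro degree_add_le) auto
    have "C = - U * (\<Sum>k<r. A ^ (r - Suc k) * V ^ k)"
      unfolding C power_diff_sumr2 by (simp add: A)
    also have "degree \<dots> \<le> degree U + (i + d) * r'"
    proof -
      have "degree (A ^ (r - Suc k) * V ^ k) \<le> (i + d) * r'" if "k < r" for k
      proof -
        have "degree (A ^ (r - Suc k) * V ^ k) \<le> degree A * (r - Suc k) + degree V * k"
          using degree_mult_le[of "A ^ (r - Suc k)" "V ^ k"] degree_power_le[of A "r - Suc k"]
            degree_power_le[of V k] by linarith
        also have "\<dots> \<le> (i + d) * (r - Suc k) + (i + d) * k"
          by (intro add_mono mult_le_mono1 dA dV)
        also have "\<dots> = (i + d) * r'" using that unfolding r' by (simp flip: distrib_left)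
        finally show ?thesis .
      qed
      then have "degree (\<Sum>k<r. A ^ (r - Suc k) * V ^ k) \<le> (i + d) * r'"
        by (intro degree_sum_le) auto
      then show ?thesis
        using degree_mult_le[of "- U" "\<Sum>k<r. A ^ (r - Suc k) * V ^ k"] by (simp; linarith)
    qed
    finally have "degree C * r \<le> (degree U + (i + d) * r') * r" by (rule mult_le_mono1)
    then have "degree (C ^ r * Q) < (degree U + (i + d) * r') * r + n"
      using degree_mult_le[of "C ^ r" Q] degree_power_le[of C r] deg(2) by linarith
    \<comment> \<open>Since \<open>degree U <= i - g\<close>, the left side is at most
      \<open>r * r * i - r * g + r * r' * d + n\<close>.\<close>
    also have "\<dots> \<le> r * r * i"
      using bound mult_le_mono2[OF u, of r] by (simp add: r' algebra_simps)
    finally show ?thesis using e by (simp add: coeff_eq_0)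
  qed
  have "(V ^ r) ^ r = monom 1 (r * r * i) * G\<^sub>1 ^ (r * r)"
    unfolding V by (simp add: monom_power power_mult_distrib power_mult[symmetric] ac_simps)
  with H have "E ^ r = monom 1 (r * r * i) * G\<^sub>1 ^ (r * r) + monom 1 (r * r * i + r * r * d + n) * H"
    by (simp add: algebra_simps)
  then have "(E ^ r - C ^ r) * Q = monom 1 (r * r * i) * (G\<^sub>1 ^ (r * r) * Q) +
      monom 1 (r * r * i + r * r * d + n) * (H * Q) + - (C ^ r * Q)"
    by (simp add: algebra_simps)
  from this L show thesis by (rule that)
qed

section \<open>The algorithm\<close>

definition ldeg :: "(nat \<times> 'a) list \<Rightarrow> nat" where
  "ldeg xs = foldl (\<lambda>d t. max d (fst t)) 0 xs"

text \<open>The condition \<open>n <= q * gap\<close> expresses the gap condition in integer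
  arithmetic, with \<open>1 / q\<close> in place of the real number \<open>c\<close>, which no
  program could handle.\<close>

definition valid :: "nat \<Rightarrow> nat \<Rightarrow> (nat \<times> 'a) list \<Rightarrow> nat \<times> nat \<Rightarrow> bool" where
  "valid q n gs p \<longleftrightarrow> fst p \<le> snd p \<and> list_all (\<lambda>t.
    (fst t < fst p \<longrightarrow> n \<le> q * (fst p - fst t)) \<and> (snd p < fst t \<longrightarrow> n \<le> q * (fst t - snd p))) gs"

definition pairs :: "(nat \<times> 'a) list \<Rightarrow> (nat \<times> nat) list" where
  "pairs gs = concat (map (\<lambda>t. map (\<lambda>u. (fst t, fst u)) gs) gs)"

text \<open>The pair \<open>(0, degree G)\<close> is always valid.\<close>

definition best :: "nat \<Rightarrow> nat \<Rightarrow> (nat \<times> 'a) list \<Rightarrow> nat \<times> nat" where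
  "best q n gs = foldl (\<lambda>b p. if valid q n gs p \<and> snd p - fst p < snd b - fst b then p else b)
    (0, ldeg gs) (pairs gs)"

text \<open>In \<open>G = U + V - W\<close>, \<open>upto_mid\<close> is \<open>U + V\<close>,
  \<open>mid\<close> is \<open>V\<close>, and \<open>neg_high\<close> is \<open>W\<close>, negated
  because \<open>W\<close> is subtracted.\<close>

definition upto_mid :: "nat \<times> nat \<Rightarrow> (nat \<times> 'a::field) list \<Rightarrow> (nat \<times> 'a) list" where
  "upto_mid p gs = filter (\<lambda>t. fst t \<le> snd p) gs"

definition mid :: "nat \<times> nat \<Rightarrow> (nat \<times> 'a::field) list \<Rightarrow> (nat \<times> 'a) list" where
  "mid p gs = filter (\<lambda>t. fst p \<le> fst t \<and> fst t \<le> snd p) gs"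

definition neg_high :: "nat \<times> nat \<Rightarrow> (nat \<times> 'a::field) list \<Rightarrow> (nat \<times> 'a) list" where
  "neg_high p gs = lneg (filter (\<lambda>t. snd p < fst t) gs)"

text \<open>The multiplier \<open>R\<close>: the second factor takes \<open>G\<close> to
  \<open>(U + V) ^ r - W ^ r = E - C\<close>, and the first takes \<open>E - C\<close> to
  \<open>E ^ r - C ^ r\<close>.\<close>

definition cofactor :: "nat \<Rightarrow> nat \<times> nat \<Rightarrow> (nat \<times> 'a::field) list \<Rightarrow> (nat \<times> 'a) list" where
  "cofactor r p gs =
    lmul
      (lgeo (lpow (mid p gs) r @ lneg (lpow (neg_high p gs) r))
            (lpow (mid p gs) r @ lneg (lpow (upto_mid p gs) r)) r)
      (lgeo (upto_mid p gs) (neg_high p gs) r)"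

definition denominator :: "nat \<Rightarrow> nat \<times> nat \<Rightarrow> (nat \<times> 'a::field) list \<Rightarrow> (nat \<times> 'a) list" where
  "denominator r p gs = lpow (lseg (fst p) (snd p) gs) (r * r)"

text \<open>With \<open>d = snd p - fst p\<close>, the window has room for \<open>D * Q\<close>,
  whose degree is at most \<open>r * r * d + (n - 1)\<close>.\<close>

definition numerator ::
  "nat \<Rightarrow> nat \<times> nat \<Rightarrow> nat \<Rightarrow> (nat \<times> 'a::field) list \<Rightarrow> (nat \<times> 'a) list \<Rightarrow> (nat \<times> 'a) list" where
  "numerator r p n gs fs =
    lseg (r * r * fst p) (r * r * fst p + r * r * (snd p - fst p) + (n - 1)) (lmul (cofactor r p gs) fs)"

definition quotient_test ::
  "nat \<Rightarrow> nat \<times> nat \<Rightarrow> nat \<Rightarrow> (nat \<times> 'a::field) list \<Rightarrow> (nat \<times> 'a) list \<Rightarrow> bool" where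
  "quotient_test r p n gs fs \<longleftrightarrow>
    lzero (lmul gs (numerator r p n gs fs) @ lneg (lmul fs (denominator r p gs))) \<and>
    lzero (lmod (denominator r p gs) (r * r * (snd p - fst p)) (numerator r p n gs fs))"

text \<open>The parameter \<open>n\<close> is not part of the input and is recovered from the
  degrees of \<open>F\<close> and \<open>G\<close>.\<close>

definition quot_len :: "(nat \<times> 'a) list \<Rightarrow> (nat \<times> 'a) list \<Rightarrow> nat" where
  "quot_len gs fs = ldeg fs + 1 - ldeg gs"

definition decide_dvd :: "nat \<Rightarrow> (nat \<times> 'a::field) list \<Rightarrow> (nat \<times> 'a) list \<Rightarrow> bool" where
  "decide_dvd q gs fs =
    (let n = quot_len gs fs; p = best q n gs in
      if n < 8 * q ^ 3 * (snd p - fst p) then lzero (lred gs (ldeg gs) n fs)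
      else quotient_test (2 * q) p n gs fs)"

section \<open>Correctness of the decision procedure\<close>

lemma validD:
  assumes "valid q n gs p" "coeff (poly_of gs) e \<noteq> 0"
  shows "e < fst p \<Longrightarrow> n \<le> q * (fst p - e)" "snd p < e \<Longrightarrow> n \<le> q * (e - snd p)"
  using assms coeff_poly_of_nonzero[OF assms(2)] by (auto simp: valid_def list_all_iff)

text \<open>After \<open>n\<close> division steps the remainder has degree below \<open>m\<close>,
  where 0 is the only multiple of \<open>G\<close>.\<close>

lemma small_correct:
  fixes gs fs :: "(nat \<times> 'a::field) list"
  assumes G: "degree (poly_of gs) = m" "poly_of gs \<noteq> 0" and F: "degree (poly_of fs) < m + n"
  shows "lzero (lred gs m n fs) \<longleftrightarrow> poly_of gs dvd poly_of fs"
proof -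
  have "poly_of gs dvd poly_of fs \<longleftrightarrow> poly_of gs dvd poly_of (lred gs m n fs)"
    using lred_dvd[of gs m n fs] by (metis dvd_diff_left_iff dvd_diff_right_iff)
  also have "\<dots> \<longleftrightarrow> poly_of (lred gs m n fs) = 0"
  proof
    assume *: "poly_of gs dvd poly_of (lred gs m n fs)"
    have "coeff (poly_of (lred gs m n fs)) e = 0" if "e \<ge> m" for e
      by (rule coeff_lred[OF G _ that]) (use F in \<open>auto intro: coeff_eq_0\<close>)
    with * show "poly_of (lred gs m n fs) = 0"
      using G by (metis dvd_imp_degree_le leading_coeff_0_iff)
  qed simp
  finally show ?thesis by simp
qed

text \<open>A successful test is sound however the numerator arose: it equals \<open>D * Q\<close>
  for some \<open>Q\<close>, and the nonzero \<open>D\<close> cancels from the identity. The gaps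
  serve the converse, where the window must contain exactly \<open>D * Q\<close>.\<close>

lemma quotient_test_correct:
  fixes gs fs :: "(nat \<times> 'a::field) list"
  assumes G: "degree (poly_of gs) = m" and F: "degree (poly_of fs) < m + n"
    and p: "valid q n gs p" "coeff (poly_of gs) (snd p) \<noteq> 0"
    and q: "q \<ge> 1" "8 * q ^ 3 * (snd p - fst p) \<le> n" and n: "n \<ge> 1"
  shows "quotient_test (2 * q) p n gs fs \<longleftrightarrow> poly_of gs dvd poly_of fs"
proof -
  define r i d where "r = 2 * q" and "i = fst p" and "d = snd p - fst p"
  have ij: "snd p = i + d" using p(1) by (simp add: valid_def i_def d_def)
  let ?G = "poly_of gs" and ?F = "poly_of fs" and ?G1 = "poly_of (lseg i (i + d) gs)"
  define V W A U where "V = poly_of (mid p gs)" and "W = poly_of (neg_high p gs)"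
    and "A = poly_of (upto_mid p gs)" and "U = A - V"
  define E C where "E = V ^ r - W ^ r" and "C = V ^ r - A ^ r"
  have coeff_V: "coeff V e = (if i \<le> e \<and> e \<le> i + d then coeff ?G e else 0)" for e
    using coeff_filter[of "\<lambda>e. i \<le> e \<and> e \<le> i + d" gs e] by (simp add: V_def mid_def ij i_def)
  have coeff_A: "coeff A e = (if e \<le> i + d then coeff ?G e else 0)" for e
    using coeff_filter[of "\<lambda>e. e \<le> i + d" gs e] by (simp add: A_def upto_mid_def ij)
  have coeff_W: "coeff W e = (if i + d < e then - coeff ?G e else 0)" for e
    using coeff_filter[of "\<lambda>e. i + d < e" gs e] by (simp add: W_def neg_high_def ij)
  have G_eq: "?G = A - W"
    by (rule poly_eqI) (simp add: coeff_A coeff_W)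
  have V_eq: "V = monom 1 i * ?G1"
    by (rule poly_eqI) (simp add: coeff_V coeff_monom_mult coeff_lseg)
  have G1: "degree ?G1 = d"
    by (rule antisym[OF degree_le le_degree]) (use p(2) in \<open>auto simp: coeff_lseg ij add.commute\<close>)
  have "coeff ?G1 d \<noteq> 0" using p(2) by (simp add: coeff_lseg ij add.commute)
  then have G1_nz: "?G1 \<noteq> 0" by auto
  have R: "poly_of (cofactor r p gs) * ?G = E ^ r - C ^ r"
  proof -
    have "poly_of (lgeo (upto_mid p gs) (neg_high p gs) r) * ?G = A ^ r - W ^ r"
      using poly_of_lgeo[of "upto_mid p gs" "neg_high p gs" r]
      by (simp add: G_eq A_def W_def mult.commute)
    also have "\<dots> = E - C" by (simp add: E_def C_def)
    finally have "poly_of (cofactor r p gs) * ?G =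
        (E - C) * poly_of (lgeo (lpow (mid p gs) r @ lneg (lpow (neg_high p gs) r))
            (lpow (mid p gs) r @ lneg (lpow (upto_mid p gs) r)) r)"
      by (simp add: cofactor_def mult.assoc)
    also have "\<dots> = E ^ r - C ^ r"
      using poly_of_lgeo[of "lpow (mid p gs) r @ lneg (lpow (neg_high p gs) r)"
          "lpow (mid p gs) r @ lneg (lpow (upto_mid p gs) r)" r]
      by (simp add: E_def C_def V_def W_def A_def)
    finally show ?thesis .
  qed
  define D where "D = ?G1 ^ (r * r)"
  have D: "poly_of (denominator r p gs) = D" "degree D = r * r * d" "D \<noteq> 0"
    using G1_nz by (simp_all add: denominator_def D_def ij i_def[symmetric] degree_power_eq G1)
  let ?P = "poly_of (numerator r p n gs fs)"
  have test: "quotient_test r p n gs fs \<longleftrightarrow> ?G * ?P = ?F * D \<and> D dvd ?P"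
    using dvd_iff_lmod[of "denominator r p gs" "r * r * d" "numerator r p n gs fs"] D
    by (simp add: quotient_test_def d_def)
  show ?thesis
    unfolding r_def[symmetric] test
  proof
    assume *: "?G * ?P = ?F * D \<and> D dvd ?P"
    then obtain Q where "?P = D * Q" by blast
    with * have "D * (?G * Q) = D * ?F" by (simp add: ac_simps)
    then show "?G dvd ?F" using D(3) by (metis dvd_triv_left mult_left_cancel)
  next
    assume "?G dvd ?F"
    then obtain Q where Q: "?F = ?G * Q" by blast
    have Q_deg: "degree Q < n"
    proof (cases "Q = 0")
      case False
      have "?G \<noteq> 0" using p(2) by auto
      with False F show ?thesis by (simp add: Q degree_mult_eq G)
    qed (use n in simp)
    \<comment> \<open>This is \<open>n / q\<close> rounded up, the least \<open>g\<close> with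
      \<open>n <= q * g\<close>; every valid gap is at least that long.\<close>
    define g where "g = (n + q - 1) div q"
    have ng: "n \<le> q * g"
    proof -
      have "n + q - 1 < q * Suc g"
        unfolding g_def mult_Suc_right using q(1) by (intro dividend_less_times_div) simp
      then show ?thesis using q(1) by simp
    qed
    have g: "g \<le> x" if "n \<le> q * x" for x
    proof -
      have "n + q - 1 < q * Suc x" using that q(1) by simp
      then have "g < Suc x"
        unfolding g_def
        by (intro div_less_iff_less_mult[THEN iffD2]) (use q(1) in \<open>simp_all add: mult.commute\<close>)
      then show ?thesis by simp
    qed
    have W: "monom 1 (i + d + g) dvd W"
      unfolding monom_1_dvd_iff' coeff_W
    proof (intro allI impI)
      fix e assume e: "e < i + d + g"
      have "coeff ?G e = 0" if "i + d < e"
        using validD(2)[OF p(1), of e] g[of "e - (i + d)"] that e unfolding ij by fastforce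
      then show "(if i + d < e then - coeff ?G e else 0) = 0" by simp
    qed
    have U: "U = 0 \<or> degree U + g \<le> i"
    proof (cases "U = 0")
      case False
      then have "coeff U (degree U) \<noteq> 0" by simp
      then have "degree U < i" "coeff ?G (degree U) \<noteq> 0"
        unfolding U_def by (auto simp: coeff_A coeff_V split: if_splits)
      then have "degree U < i" "g \<le> i - degree U"
        using validD(1)[OF p(1), of "degree U"] g[of "i - degree U"] by (simp_all add: i_def)
      then show ?thesis by linarith
    qed simp
    have A: "A = U + V" by (simp add: U_def)
    obtain H L where HL: "(E ^ r - C ^ r) * Q =
      monom 1 (r * r * i) * (D * Q) + monom 1 (r * r * i + r * r * d + n) * H + L"
      "\<And>e. e \<ge> r * r * i \<Longrightarrow> coeff L e = 0"
      unfolding D_def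
      by (rule window[OF A V_eq eq_refl[OF G1] Q_deg W U E_def C_def r_def q(1) ng q(2)[folded d_def]]) blast
    have "?P = D * Q"
    proof (rule poly_eqI)
      fix e
      have "?F * poly_of (cofactor r p gs) = (E ^ r - C ^ r) * Q"
        unfolding Q R[symmetric] by (simp add: ac_simps)
      then have P: "coeff ?P e = (if e \<le> r * r * d + (n - 1)
          then coeff ((E ^ r - C ^ r) * Q) (e + r * r * i) else 0)"
        by (simp add: numerator_def coeff_lseg i_def d_def mult.commute)
      show "coeff ?P e = coeff (D * Q) e"
      proof (cases "e \<le> r * r * d + (n - 1)")
        case True
        \<comment> \<open>The exponent \<open>e + r * r * i\<close> lies below the \<open>H\<close>
          part and not below \<open>r * r * i\<close>, so only \<open>D * Q\<close>
          contributes.\<close>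
        with n show ?thesis unfolding P HL(1) by (simp add: coeff_monom_mult HL(2))
      next
        case False
        have "degree (D * Q) \<le> r * r * d + (n - 1)"
          using degree_mult_le[of D Q] D(2) Q_deg by linarith
        with False show ?thesis unfolding P by (simp add: coeff_eq_0)
      qed
    qed
    then show "?G * ?P = ?F * D \<and> D dvd ?P" by (simp add: Q ac_simps)
  qed
qed

lemma foldl_argmin:
  fixes w :: "'x \<Rightarrow> 'y::linorder" and Q :: "'x \<Rightarrow> bool"
  defines "r \<equiv> foldl (\<lambda>b p. if Q p \<and> w p < w b then p else b)"
  shows "r b ps = b \<or> r b ps \<in> set ps \<and> Q (r b ps)"
    and "p \<in> set ps \<Longrightarrow> Q p \<Longrightarrow> w (r b ps) \<le> w p"
proof -
  have "(r b ps = b \<or> r b ps \<in> set ps \<and> Q (r b ps)) \<and> w (r b ps) \<le> w b \<and>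
      (\<forall>p\<in>set ps. Q p \<longrightarrow> w (r b ps) \<le> w p)"
  proof (induction ps arbitrary: b)
    case (Cons a ps)
    have r: "r b (a # ps) = r (if Q a \<and> w a < w b then a else b) ps" by (simp add: r_def)
    show ?case
      using Cons[of a] Cons[of b] unfolding r by auto
  qed (simp add: r_def)
  then show "r b ps = b \<or> r b ps \<in> set ps \<and> Q (r b ps)"
    and "p \<in> set ps \<Longrightarrow> Q p \<Longrightarrow> w (r b ps) \<le> w p" by auto
qed

lemma sparse_repD:
  fixes p :: "'a::field poly"
  assumes "sparse_rep xs p"
  shows sparse_rep_poly_of: "poly_of xs = p"
    and sparse_rep_length: "length xs = sparsity p"
    and sparse_rep_coeff: "t \<in> set xs \<Longrightarrow> coeff p (fst t) \<noteq> 0"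
    and sparse_rep_ldeg: "ldeg xs = degree p"
proof -
  let ?E = "{e. coeff p e \<noteq> 0}"
  have xs: "distinct xs" "set xs = (\<lambda>e. (e, coeff p e)) ` ?E"
    using assms by (auto simp: sparse_rep_def)
  have inj: "inj_on (\<lambda>e. (e, coeff p e)) ?E" by (rule inj_onI) simp
  have sub: "?E \<subseteq> {..degree p}" by (auto intro: le_degree)
  have "poly_of xs = (\<Sum>t\<in>set xs. monom (snd t) (fst t))"
    unfolding poly_of_def by (rule sum_list_distinct_conv_sum_set[OF xs(1)])
  also have "\<dots> = (\<Sum>e\<in>?E. monom (coeff p e) e)"
    unfolding xs(2) by (simp add: sum.reindex[OF inj])
  also have "\<dots> = (\<Sum>e\<le>degree p. monom (coeff p e) e)"
    by (rule sum.mono_neutral_left) (use sub in auto)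
  also have "\<dots> = p" by (rule poly_as_sum_of_monoms)
  finally show "poly_of xs = p" .
  show "length xs = sparsity p"
    using distinct_card[OF xs(1)] unfolding xs(2) card_image[OF inj] sparsity_def by simp
  show t: "coeff p (fst t) \<noteq> 0" if "t \<in> set xs" for t
    using that unfolding xs(2) by auto
  have foldl: "foldl (\<lambda>d t. max d (fst t)) d ys = Max (insert d (fst ` set ys))"
    for d and ys :: "(nat \<times> 'a) list"
  proof (induction ys arbitrary: d)
    case (Cons t ys)
    have "Max (insert (max d (fst t)) X) = Max (insert d (insert (fst t) X))" if "finite X" for X
      using that by (cases "X = {}") (simp_all add: max.assoc)
    with Cons show ?case by simp
  qed simp
  show "ldeg xs = degree p"
    unfolding ldeg_def foldl
  proof (rule Max_eqI)
    show "degree p \<in> insert 0 (fst ` set xs)"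
      unfolding xs(2) image_image by (cases "p = 0") auto
  qed (use t in \<open>auto intro: le_degree\<close>)
qed

text \<open>That the upper exponent carries a term of \<open>G\<close> makes the width of the pair
  equal to the degree of the middle part. The last claim later compares the chosen pair with the one
  given by the promised decomposition.\<close>

lemma best_correct:
  fixes G :: "'a::field poly"
  assumes gs: "sparse_rep gs G" and G: "G \<noteq> 0"
  shows "valid q n gs (best q n gs)" "coeff G (snd (best q n gs)) \<noteq> 0"
    and "coeff G i \<noteq> 0 \<Longrightarrow> coeff G j \<noteq> 0 \<Longrightarrow> valid q n gs (i, j) \<Longrightarrow>
      snd (best q n gs) - fst (best q n gs) \<le> j - i"
proof -
  note argmin = foldl_argmin[where Q = "valid q n gs" and w = "\<lambda>p. snd p - fst p"
      and b = "(0, ldeg gs)" and ps = "pairs gs", folded best_def]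
  have "valid q n gs (0, ldeg gs)"
    using sparse_rep_coeff[OF gs] sparse_rep_ldeg[OF gs]
    by (fastforce simp: valid_def list_all_iff dest: le_degree)
  with argmin(1) show "valid q n gs (best q n gs)" by metis
  show "coeff G (snd (best q n gs)) \<noteq> 0"
    using argmin(1)
  proof
    assume "best q n gs = (0, ldeg gs)"
    with G sparse_rep_ldeg[OF gs] show ?thesis by simp
  next
    assume "best q n gs \<in> set (pairs gs) \<and> valid q n gs (best q n gs)"
    then show ?thesis using sparse_rep_coeff[OF gs] by (auto simp: pairs_def)
  qed
  assume ij: "coeff G i \<noteq> 0" "coeff G j \<noteq> 0" "valid q n gs (i, j)"
  then have "i \<in> fst ` set gs" "j \<in> fst ` set gs"
    using coeff_poly_of_nonzero sparse_rep_poly_of[OF gs] by blast+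
  then obtain t u where "t \<in> set gs" "u \<in> set gs" "i = fst t" "j = fst u" by blast
  then have "(i, j) \<in> set (pairs gs)" by (auto simp: pairs_def)
  from argmin(2)[OF this ij(3)] show "snd (best q n gs) - fst (best q n gs) \<le> j - i" by simp
qed

text \<open>The answer is right for whichever valid pair \<open>best\<close> returns. The promised
  decomposition guarantees that this pair is narrow, which bounds the running time.\<close>

lemma decide_dvd_correct:
  assumes gs: "sparse_rep gs G" and fs: "sparse_rep fs F" and G: "G \<noteq> 0" "degree G = m"
    and F: "degree F = m + n - 1" and n: "n \<ge> 1" and q: "q \<ge> 1"
  shows "decide_dvd q gs fs \<longleftrightarrow> G dvd F"
proof -
  have [simp]: "quot_len gs fs = n" "ldeg gs = m"
    using n by (simp_all add: quot_len_def sparse_rep_ldeg[OF gs] sparse_rep_ldeg[OF fs] G F)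
  have "degree F < m + n" using F n by simp
  with small_correct[of gs m fs n] quotient_test_correct[of gs m fs n q "best q n gs"]
    best_correct(1,2)[OF gs G(1), of q n] G n q
  show ?thesis
    unfolding decide_dvd_def Let_def
    by (auto simp: sparse_rep_poly_of[OF gs] sparse_rep_poly_of[OF fs])
qed

section \<open>The algorithm runs in polynomial time\<close>

definition pair_val :: "nat \<times> nat \<Rightarrow> 'a val" where
  "pair_val p = Cell (Num (fst p)) (Num (snd p))"

lemma PT_pair_val:
  "PT S A U (\<lambda>i. Num (x i)) \<Longrightarrow> PT S A U (\<lambda>i. Num (y i)) \<Longrightarrow> PT S A U (\<lambda>i. pair_val (x i, y i))"
  unfolding pair_val_def fst_conv snd_conv by (rule PT_pair)

lemma PT_pair_val_fst: "PT S A U (\<lambda>i. pair_val (p i)) \<Longrightarrow> PT S A U (\<lambda>i. Num (fst (p i)))"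
  and PT_pair_val_snd: "PT S A U (\<lambda>i. pair_val (p i)) \<Longrightarrow> PT S A U (\<lambda>i. Num (snd (p i)))"
  unfolding pair_val_def by (erule PT_left, erule PT_right)

lemma PT_ldeg:
  fixes S :: "'i \<Rightarrow> nat" and U :: "'i \<Rightarrow> 'a::field val"
  assumes xs: "PT S A U (\<lambda>i. poly_val (xs i))"
  shows "PT S A U (\<lambda>i. Num (ldeg (xs i)))"
  unfolding ldeg_def
proof (rule PT_foldl[where eb = Num and a = "\<lambda>_. 0", OF xs PT_Num_const PT_size[OF xs]])
  have "vsize (Num (foldl (\<lambda>d t. max d (fst t)) d ys) :: 'a val) \<le>
      max (vsize (Num d :: 'a val)) (vsize (poly_val (ys @ zs)))"
    for d and ys zs :: "(nat \<times> 'a) list"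
  proof (induction ys arbitrary: d)
    case (Cons t ys)
    from Cons[of "max d (fst t)"] show ?case by (auto simp: max_def vsize_term_val split: if_splits)
  qed simp
  note le = this
  show "vsize (Num (foldl (\<lambda>d t. max d (fst t)) 0 ys) :: 'a val) \<le> vsize (poly_val (xs i))"
    if "xs i = ys @ zs" for i ys zs
  proof -
    have "vsize (Num 0 :: 'a val) \<le> vsize (poly_val (ys @ zs))"
      using vsize_pos[of "poly_val (ys @ zs)"] by (simp del: vl.simps)
    from max.absorb2[OF this] le[of 0 ys zs] show ?thesis by (simp only: that)
  qed
next
  fix B and U' :: "'i \<times> nat \<times> nat \<times> 'a \<Rightarrow> 'a val"
  assume d: "PT (\<lambda>j. S (fst j)) B U' (\<lambda>j. Num (fst (snd j)))"
    and t: "PT (\<lambda>j. S (fst j)) B U' (\<lambda>j. term_val (snd (snd j)))"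
  show "PT (\<lambda>j. S (fst j)) B U' (\<lambda>j. Num (max (fst (snd j)) (fst (snd (snd j)))))"
    unfolding max_def by (rule PT_if'[where e = Num]) (intro PT_le d PT_exponent[OF t])+
qed

lemma PT_valid:
  fixes S :: "'i \<Rightarrow> nat" and U :: "'i \<Rightarrow> 'a::field val"
  assumes n: "PT S A U (\<lambda>i. Num (n i))" and gs: "PT S A U (\<lambda>i. poly_val (gs i))"
    and p: "PT S A U (\<lambda>i. pair_val (p i))"
  shows "PT S A U (\<lambda>i. Bit (valid q (n i) (gs i) (p i)))"
proof -
  let ?Q = "\<lambda>i t. (fst t < fst (p i) \<longrightarrow> n i \<le> q * (fst (p i) - fst t)) \<and>
    (snd (p i) < fst t \<longrightarrow> n i \<le> q * (fst t - snd (p i)))"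
  have "PT S A U (\<lambda>i. Bit (list_all (?Q i) (gs i)))"
  proof (rule PT_list_all[OF gs])
    fix B and U' :: "'i \<times> nat \<times> 'a \<Rightarrow> 'a val"
    assume lift: "\<And>V. PT S A U V \<Longrightarrow> PT (\<lambda>j. S (fst j)) B U' (\<lambda>j. V (fst j))"
      and t: "PT (\<lambda>j. S (fst j)) B U' (\<lambda>j. term_val (snd j))"
    note p' = lift[OF PT_pair_val_fst[OF p]] lift[OF PT_pair_val_snd[OF p]]
    show "PT (\<lambda>j. S (fst j)) B U' (\<lambda>j. Bit (?Q (fst j) (snd j)))"
      by (intro PT_conj PT_imp PT_less PT_le PT_mult PT_sub PT_Num_const PT_exponent[OF t] p' lift[OF n])
  qed
  then show ?thesis
    unfolding valid_def by (intro PT_conj PT_le PT_pair_val_fst[OF p] PT_pair_val_snd[OF p])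
qed

lemma PT_pairs:
  fixes S :: "'i \<Rightarrow> nat" and U :: "'i \<Rightarrow> 'a::field val"
  assumes gs: "PT S A U (\<lambda>i. poly_val (gs i))"
  shows "PT S A U (\<lambda>i. vl pair_val (pairs (gs i)))"
  unfolding pairs_def
proof (rule PT_concat, rule PT_map[OF gs])
  fix B and U' :: "'i \<times> nat \<times> 'a \<Rightarrow> 'a val"
  assume lift: "\<And>V. PT S A U V \<Longrightarrow> PT (\<lambda>j. S (fst j)) B U' (\<lambda>j. V (fst j))"
    and t: "PT (\<lambda>j. S (fst j)) B U' (\<lambda>j. term_val (snd j))"
  show "PT (\<lambda>j. S (fst j)) B U' (\<lambda>j. vl pair_val (map (\<lambda>u. (fst (snd j), fst u)) (gs (fst j))))"
  proof (rule PT_map[OF lift[OF gs]])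
    fix B' and U'' :: "('i \<times> nat \<times> 'a) \<times> nat \<times> 'a \<Rightarrow> 'a val"
    assume lift': "\<And>V. PT (\<lambda>j. S (fst j)) B U' V \<Longrightarrow>
        PT (\<lambda>j. S (fst (fst j))) B' U'' (\<lambda>j. V (fst j))"
      and u: "PT (\<lambda>j. S (fst (fst j))) B' U'' (\<lambda>j. term_val (snd j))"
    show "PT (\<lambda>j. S (fst (fst j))) B' U'' (\<lambda>j. pair_val (fst (snd (fst j)), fst (snd j)))"
      by (intro PT_pair_val PT_exponent[OF u] lift'[OF PT_exponent[OF t]])
  qed
qed

text \<open>The accumulator is always the initial pair or a member of the list of pairs, so it never
  outgrows their encodings.\<close>

lemma PT_best:
  fixes S :: "'i \<Rightarrow> nat" and U :: "'i \<Rightarrow> 'a::field val"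
  assumes n: "PT S A U (\<lambda>i. Num (n i))" and gs: "PT S A U (\<lambda>i. poly_val (gs i))"
  shows "PT S A U (\<lambda>i. pair_val (best q (n i) (gs i)))"
  unfolding best_def
proof (rule PT_foldl[where eb = pair_val and a = "\<lambda>i. (0, ldeg (gs i))", OF PT_pairs[OF gs]])
  show init: "PT S A U (\<lambda>i. pair_val (0, ldeg (gs i)))"
    by (intro PT_pair_val PT_Num_const PT_ldeg gs)
  show "pbd S A (\<lambda>i. vsize (pair_val (0, ldeg (gs i)) :: 'a val) + vsize (vl pair_val (pairs (gs i)) :: 'a val))"
    by (intro pbd_intros PT_size[OF init] PT_size[OF PT_pairs[OF gs]])
next
  fix i ys zs
  assume ps: "pairs (gs i) = ys @ zs"
  let ?r = "foldl (\<lambda>b p. if valid q (n i) (gs i) p \<and> snd p - fst p < snd b - fst b then p else b)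
    (0, ldeg (gs i)) ys"
  have "?r = (0, ldeg (gs i)) \<or> ?r \<in> set ys \<and> valid q (n i) (gs i) ?r"
    using foldl_argmin(1)[where Q = "valid q (n i) (gs i)" and w = "\<lambda>p. snd p - fst p"] by fast
  then show "vsize (pair_val ?r :: 'a val) \<le>
      vsize (pair_val (0, ldeg (gs i)) :: 'a val) + vsize (vl pair_val (pairs (gs i)) :: 'a val)"
  proof
    assume "?r \<in> set ys \<and> valid q (n i) (gs i) ?r"
    then have "vsize (pair_val ?r :: 'a val) \<le> vsize (vl pair_val (pairs (gs i)) :: 'a val)"
      unfolding ps by (intro vsize_le_vsize_vl) auto
    then show ?thesis by simp
  qed simp
next
  fix B and U' :: "'i \<times> (nat \<times> nat) \<times> nat \<times> nat \<Rightarrow> 'a val"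
  assume lift: "\<And>V. PT S A U V \<Longrightarrow> PT (\<lambda>j. S (fst j)) B U' (\<lambda>j. V (fst j))"
    and b: "PT (\<lambda>j. S (fst j)) B U' (\<lambda>j. pair_val (fst (snd j)))"
    and p: "PT (\<lambda>j. S (fst j)) B U' (\<lambda>j. pair_val (snd (snd j)))"
  show "PT (\<lambda>j. S (fst j)) B U' (\<lambda>j. pair_val
      (if valid q (n (fst j)) (gs (fst j)) (snd (snd j)) \<and>
          snd (snd (snd j)) - fst (snd (snd j)) < snd (fst (snd j)) - fst (fst (snd j))
       then snd (snd j) else fst (snd j)))"
    by (intro PT_if'[where e = pair_val] PT_conj PT_less PT_sub PT_valid lift[OF n] lift[OF gs] b p
        PT_pair_val_fst[OF b] PT_pair_val_snd[OF b] PT_pair_val_fst[OF p] PT_pair_val_snd[OF p])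
qed

lemma PT_filter_exponent:
  fixes S :: "'i \<Rightarrow> nat" and U :: "'i \<Rightarrow> 'a::field val"
  assumes gs: "PT S A U (\<lambda>i. poly_val (gs i))" and p: "PT S A U (\<lambda>i. pair_val (p i))"
  shows PT_upto_mid: "PT S A U (\<lambda>i. poly_val (upto_mid (p i) (gs i)))"
    and PT_mid: "PT S A U (\<lambda>i. poly_val (mid (p i) (gs i)))"
    and PT_neg_high: "PT S A U (\<lambda>i. poly_val (neg_high (p i) (gs i)))"
proof -
  show "PT S A U (\<lambda>i. poly_val (upto_mid (p i) (gs i)))"
    unfolding upto_mid_def
  proof (rule PT_filter[OF gs])
    fix B and U' :: "'i \<times> nat \<times> 'a \<Rightarrow> 'a val"
    assume lift: "\<And>V. PT S A U V \<Longrightarrow> PT (\<lambda>j. S (fst j)) B U' (\<lambda>j. V (fst j))"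
      and t: "PT (\<lambda>j. S (fst j)) B U' (\<lambda>j. term_val (snd j))"
    show "PT (\<lambda>j. S (fst j)) B U' (\<lambda>j. Bit (fst (snd j) \<le> snd (p (fst j))))"
      by (intro PT_le PT_exponent[OF t] lift[OF PT_pair_val_snd[OF p]])
  qed
  show "PT S A U (\<lambda>i. poly_val (mid (p i) (gs i)))"
    unfolding mid_def
  proof (rule PT_filter[OF gs])
    fix B and U' :: "'i \<times> nat \<times> 'a \<Rightarrow> 'a val"
    assume lift: "\<And>V. PT S A U V \<Longrightarrow> PT (\<lambda>j. S (fst j)) B U' (\<lambda>j. V (fst j))"
      and t: "PT (\<lambda>j. S (fst j)) B U' (\<lambda>j. term_val (snd j))"
    show "PT (\<lambda>j. S (fst j)) B U' (\<lambda>j. Bit (fst (p (fst j)) \<le> fst (snd j) \<and> fst (snd j) \<le> snd (p (fst j))))"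
      by (intro PT_conj PT_le PT_exponent[OF t] lift[OF PT_pair_val_fst[OF p]] lift[OF PT_pair_val_snd[OF p]])
  qed
  show "PT S A U (\<lambda>i. poly_val (neg_high (p i) (gs i)))"
    unfolding neg_high_def
  proof (intro PT_lneg PT_filter[OF gs])
    fix B and U' :: "'i \<times> nat \<times> 'a \<Rightarrow> 'a val"
    assume lift: "\<And>V. PT S A U V \<Longrightarrow> PT (\<lambda>j. S (fst j)) B U' (\<lambda>j. V (fst j))"
      and t: "PT (\<lambda>j. S (fst j)) B U' (\<lambda>j. term_val (snd j))"
    show "PT (\<lambda>j. S (fst j)) B U' (\<lambda>j. Bit (snd (p (fst j)) < fst (snd j)))"
      by (intro PT_less PT_exponent[OF t] lift[OF PT_pair_val_snd[OF p]])
  qed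
qed

text \<open>Remainders modulo the denominator are tabulated with \<open>r * r\<close> times as many
  entries as the width of the pair, hence the bound on the width itself.\<close>

lemma PT_quotient_test:
  assumes n: "PT S A U (\<lambda>i. Num (n i))" and gs: "PT S A U (\<lambda>i. poly_val (gs i))"
    and fs: "PT S A U (\<lambda>i. poly_val (fs i))" and p: "PT S A U (\<lambda>i. pair_val (p i))"
    and span: "pbd S A (\<lambda>i. snd (p i) - fst (p i))"
  shows "PT S A U (\<lambda>i. Bit (quotient_test r (p i) (n i) (gs i) (fs i)))"
proof -
  note p' = PT_pair_val_fst[OF p] PT_pair_val_snd[OF p]
  have cof: "PT S A U (\<lambda>i. poly_val (cofactor r (p i) (gs i)))"
    unfolding cofactor_def
    by (intro PT_lmul PT_lgeo PT_append PT_lneg PT_lpow PT_upto_mid PT_mid PT_neg_high gs p)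
  have num: "PT S A U (\<lambda>i. poly_val (numerator r (p i) (n i) (gs i) (fs i)))"
    unfolding numerator_def by (intro PT_lseg PT_add PT_mult PT_sub PT_Num_const PT_lmul cof fs n p')
  have den: "PT S A U (\<lambda>i. poly_val (denominator r (p i) (gs i)))"
    unfolding denominator_def by (intro PT_lpow PT_lseg gs p')
  have deg: "PT S A U (\<lambda>i. Num (r * r * (snd (p i) - fst (p i))))"
    by (intro PT_mult PT_sub PT_Num_const p')
  have "pbd S A (\<lambda>i. r * r * (snd (p i) - fst (p i)))"
    by (intro pbd_intros span)
  then show ?thesis
    unfolding quotient_test_def
    by (intro PT_conj PT_lzero PT_append PT_lneg PT_lmul PT_lmod gs fs num den deg)
qed

lemma PT_decide_dvd:
  assumes gs: "PT S A U (\<lambda>i. poly_val (gs i))" and fs: "PT S A U (\<lambda>i. poly_val (fs i))"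
    and span: "pbd S A (\<lambda>i. snd (best q (quot_len (gs i) (fs i)) (gs i))
      - fst (best q (quot_len (gs i) (fs i)) (gs i)))"
  shows "PT S A U (\<lambda>i. Bit (decide_dvd q (gs i) (fs i)))"
proof -
  let ?n = "\<lambda>i. quot_len (gs i) (fs i)" and ?p = "\<lambda>i. best q (quot_len (gs i) (fs i)) (gs i)"
  let ?d = "\<lambda>i. snd (?p i) - fst (?p i)"
  have n: "PT S A U (\<lambda>i. Num (?n i))"
    unfolding quot_len_def by (intro PT_sub PT_add PT_Num_const PT_ldeg gs fs)
  have p: "PT S A U (\<lambda>i. pair_val (?p i))"
    by (intro PT_best n gs)
  let ?A = "{i \<in> A. ?n i < 8 * q ^ 3 * ?d i}" and ?A' = "{i \<in> A. \<not> ?n i < 8 * q ^ 3 * ?d i}"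
  have bd: "pbd S A (\<lambda>i. 8 * q ^ 3 * ?d i)" by (intro pbd_intros span)
  have "PT S A U (\<lambda>i. Bit (?n i < 8 * q ^ 3 * ?d i))"
    by (intro PT_less PT_mult[OF PT_Num_const] PT_sub PT_pair_val_fst[OF p] PT_pair_val_snd[OF p] n)
  moreover have "PT S ?A U (\<lambda>i. Bit (lzero (lred (gs i) (ldeg (gs i)) (?n i) (fs i))))"
  proof -
    \<comment> \<open>In this branch \<open>n\<close> lies below a constant times the width, so the
      number of division steps is polynomial.\<close>
    have "pbd S ?A ?n"
      by (rule pbd_mono[OF pbd_subset[OF bd]]) auto
    then show ?thesis
      by (intro PT_lzero PT_lred PT_ldeg;
        (intro PT_subset[OF gs] PT_subset[OF fs] PT_subset[OF n])?; (assumption | blast)?)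
  qed
  moreover have "PT S ?A' U (\<lambda>i. Bit (quotient_test (2 * q) (?p i) (?n i) (gs i) (fs i)))"
    by (rule PT_subset[of S A], rule PT_quotient_test[OF n gs fs p span]) auto
  ultimately have "PT S A U (\<lambda>i. if ?n i < 8 * q ^ 3 * ?d i
      then Bit (lzero (lred (gs i) (ldeg (gs i)) (?n i) (fs i)))
      else Bit (quotient_test (2 * q) (?p i) (?n i) (gs i) (fs i)))"
    by (rule PT_if_rel)
  then show ?thesis by (rule PT_cong) (simp add: decide_dvd_def Let_def)
qed

section \<open>Bounds by the input size\<close>

lemma pdeg_eq_iff: "pdeg p = ereal x \<longleftrightarrow> p \<noteq> 0 \<and> real (degree p) = x"
  by (auto simp: pdeg_def)

text \<open>The decomposition yields one valid pair: the lowest and the highest exponent of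
  \<open>X ^ k * G\<^sub>1\<close>. The positive gaps keep the terms of the three parts of
  \<open>G\<close> from meeting, so neither end cancels.\<close>

lemma span_bound:
  fixes G :: "'a::field poly"
  assumes gs: "sparse_rep gs G"
    and G: "G = G\<^sub>0 + monom 1 k * G\<^sub>1 - monom 1 l * G\<^sub>2" "G\<^sub>1 \<noteq> 0"
    and gaps: "ereal (real k) - pdeg G\<^sub>0 \<ge> ereal (c * real n)"
      "ereal (real l) - ereal (real k) - pdeg G\<^sub>1 \<ge> ereal (c * real n)"
    and c: "c > 0" "c * real q \<ge> 1" and n: "n \<ge> 1"
  shows "snd (best q n gs) - fst (best q n gs) \<le> degree G\<^sub>1"
proof -
  have cn: "c * real n > 0" using c n by simp
  have scale: "n \<le> q * x" if "c * real n \<le> real x" for x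
  proof -
    have "real n * 1 \<le> real n * (c * real q)" by (intro mult_left_mono c) simp
    also have "\<dots> = (c * real n) * real q" by simp
    also have "\<dots> \<le> real x * real q" using that by (intro mult_right_mono) auto
    finally have "real n \<le> real (q * x)" by (simp add: mult.commute)
    then show ?thesis by linarith
  qed
  have low: "e < k \<and> c * real n \<le> real k - real e" if "coeff G\<^sub>0 e \<noteq> 0" for e
  proof -
    have "G\<^sub>0 \<noteq> 0" using that by auto
    then have "c * real n \<le> real k - real (degree G\<^sub>0)" using gaps(1) by (simp add: pdeg_def)
    with le_degree[OF that] cn show ?thesis by linarith
  qed
  have high: "c * real n \<le> real l - real k - real (degree G\<^sub>1)"
    using gaps(2) G(2) by (simp add: pdeg_def)
  then have l: "k + degree G\<^sub>1 < l" using cn by linarith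
  \<comment> \<open>Candidate pairs consist of exponents of \<open>G\<close>. The coefficient at
    \<open>k\<close> may vanish, so the lower end is \<open>k + v\<close>.\<close>
  define v where "v = (LEAST e. coeff G\<^sub>1 e \<noteq> 0)"
  have lead: "coeff G\<^sub>1 (degree G\<^sub>1) \<noteq> 0" using G(2) by simp
  then have v: "coeff G\<^sub>1 v \<noteq> 0" unfolding v_def by (rule LeastI)
  have below_v: "coeff G\<^sub>1 e = 0" if "e < v" for e
    using that not_less_Least unfolding v_def by blast
  have vd: "v \<le> degree G\<^sub>1" by (rule le_degree[OF v])
  have coeff_G: "coeff G e = coeff G\<^sub>0 e + (if k \<le> e then coeff G\<^sub>1 (e - k) else 0)
      - (if l \<le> e then coeff G\<^sub>2 (e - l) else 0)" for e
    unfolding G(1) by (simp add: coeff_monom_mult)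
  have low0: "coeff G\<^sub>0 e = 0" if "k \<le> e" for e
    using low[of e] that by auto
  have "coeff G (k + v) \<noteq> 0" "coeff G (k + degree G\<^sub>1) \<noteq> 0"
    using v lead l vd low0 by (simp_all add: coeff_G)
  moreover have "valid q n gs (k + v, k + degree G\<^sub>1)"
    unfolding valid_def fst_conv snd_conv list_all_iff
  proof (intro conjI ballI impI)
    show "k + v \<le> k + degree G\<^sub>1" using vd by simp
    fix t assume "t \<in> set gs"
    then have t: "coeff G (fst t) \<noteq> 0" by (rule sparse_rep_coeff[OF gs])
    show "n \<le> q * (k + v - fst t)" if "fst t < k + v"
    proof (rule scale)
      have "coeff G\<^sub>0 (fst t) \<noteq> 0"
        using t that l vd below_v[of "fst t - k"] by (auto simp: coeff_G split: if_splits)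
      with low[of "fst t"] show "c * real n \<le> real (k + v - fst t)" by linarith
    qed
    show "n \<le> q * (fst t - (k + degree G\<^sub>1))" if "k + degree G\<^sub>1 < fst t"
    proof (rule scale)
      have "coeff G\<^sub>1 (fst t - k) = 0" using that by (intro coeff_eq_0) linarith
      with t low0[of "fst t"] that have "l \<le> fst t" by (auto simp: coeff_G split: if_splits)
      with high that show "c * real n \<le> real (fst t - (k + degree G\<^sub>1))" by linarith
    qed
  qed
  ultimately have "snd (best q n gs) - fst (best q n gs) \<le> (k + degree G\<^sub>1) - (k + v)"
    using gs by (intro best_correct(3)) auto
  then show ?thesis by simp
qed

text \<open>Coefficients may be negative or fractional. Each is replaced by its absolute value
  rounded up, and each factor \<open>x\<close> by \<open>1 + x\<close>.\<close>

lemma poly_le_power: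
  fixes p :: "real poly"
  shows "\<exists>a b :: nat. \<forall>x\<ge>0. poly p x \<le> real a * (1 + x) ^ b"
proof (induction p)
  case (pCons c p)
  then obtain a b :: nat where ab: "\<And>x. x \<ge> 0 \<Longrightarrow> poly p x \<le> real a * (1 + x) ^ b" by blast
  have "poly (pCons c p) x \<le> real (nat \<lceil>\<bar>c\<bar>\<rceil> + a) * (1 + x) ^ Suc b" if x: "x \<ge> 0" for x
  proof -
    let ?K = "real (nat \<lceil>\<bar>c\<bar>\<rceil>)"
    have "c \<le> ?K * 1" by linarith
    also have "\<dots> \<le> ?K * (1 + x) ^ Suc b"
      by (rule mult_left_mono, rule one_le_power) (use x in simp_all)
    finally have "c \<le> ?K * (1 + x) ^ Suc b" .
    moreover have "x * poly p x \<le> x * (real a * (1 + x) ^ b)"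
      by (rule mult_left_mono[OF ab[OF x] x])
    moreover have "x * (real a * (1 + x) ^ b) \<le> (1 + x) * (real a * (1 + x) ^ b)"
      by (rule mult_right_mono) (use x in simp_all)
    ultimately have "poly (pCons c p) x \<le> ?K * (1 + x) ^ Suc b + (1 + x) * (real a * (1 + x) ^ b)"
      by simp
    then show ?thesis by (simp add: algebra_simps)
  qed
  then show ?case by blast
qed auto

lemma floorlog_le_log:
  assumes "e < N" shows "real (floorlog 2 e) \<le> 1 + log 2 (real N)"
proof (cases "e = 0")
  case True
  then show ?thesis using assms by simp
next
  case False
  then have "real (floorlog 2 e) \<le> 1 + log 2 (real e)"
    by (simp add: floorlog_def)
  also have "log 2 (real e) \<le> log 2 (real N)"
    using False assms by simp
  finally show ?thesis by simp
qed

lemma vsize_input: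
  fixes p :: "'a::field poly"
  assumes xs: "sparse_rep xs p" and deg: "degree p < N" and T: "sparsity p \<le> T" "T \<ge> 1"
    and s: "real T * log 2 (real N) \<le> real s"
  shows "vsize (poly_val xs) \<le> 1 + (s + 1) * (1 + (3 + (s + 1)))"
proof -
  have N: "N \<ge> 1" using deg by simp
  have log: "log 2 (real N) \<le> real s"
    using s T(2) mult_right_mono[of 1 "real T" "log 2 (real N)"] N by simp
  have "length xs \<le> s + 1"
  \<comment> \<open>For \<open>N = 1\<close> the logarithm is 0 and \<open>s\<close> says nothing
    about \<open>T\<close>, but then \<open>p\<close> is constant and has at most one term. This
    accounts for \<open>s + 1\<close>.\<close>
  proof (cases "N = 1")
    case True
    then have "{e. coeff p e \<noteq> 0} \<subseteq> {0}" using deg by (auto dest: le_degree)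
    then have "card {e. coeff p e \<noteq> 0} \<le> card {0::nat}" by (intro card_mono) auto
    then show ?thesis using sparse_rep_length[OF xs] by (simp add: sparsity_def)
  next
    case False
    then have "log 2 2 \<le> log 2 (real N)" using N by (subst log_le_cancel_iff) auto
    then have "real T * 1 \<le> real T * log 2 (real N)" by (intro mult_left_mono) auto
    with s T(1) sparse_rep_length[OF xs] show ?thesis by linarith
  qed
  have "vsize (term_val t) \<le> 3 + (s + 1)" if "t \<in> set xs" for t
  proof -
    have "fst t < N" using le_degree[OF sparse_rep_coeff[OF xs that]] deg by simp
    from floorlog_le_log[OF this] log show ?thesis unfolding vsize_term_val by linarith
  qed
  then have "vsize (poly_val xs) \<le> 1 + length xs * (1 + (3 + (s + 1)))"
    by (rule vsize_vl_le)
  also have "\<dots> \<le> 1 + (s + 1) * (1 + (3 + (s + 1)))"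
    using \<open>length xs \<le> s + 1\<close> by (intro add_left_mono mult_right_mono) auto
  finally show ?thesis .
qed

text \<open>The input occupies registers 0 and 1, while the programs built here take one argument in
  register 0 and use register 1 as a stack. One additional cell joins the two conventions.\<close>

lemma PT_answers:
  assumes "PT S A (\<lambda>i. Cell (poly_val (fs i)) (poly_val (gs i))) (\<lambda>i. Bit (Q i))"
  shows "\<exists>p a b. \<forall>i\<in>A. answers p (input (fs i) (gs i)) (Q i) (real a * (real (S i) + 1) ^ b)"
proof -
  obtain p a b where p: "\<And>i. i \<in> A \<Longrightarrow> runs p (Cell (poly_val (fs i)) (poly_val (gs i)))
      (a * (S i + 1) ^ b) (Bit (Q i))"
    using assms unfolding PT_def RT_def pbd_def by (metis runs_mono)
  let ?p = "Seq (Assign 0 (ECell 0 1)) p"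
  have "answers ?p (input (fs i) (gs i)) (Q i) (real (1 + a) * (real (S i) + 1) ^ b)" if i: "i \<in> A" for i
  proof -
    let ?s = "input (fs i) (gs i)"
    let ?u = "Cell (poly_val (fs i)) (poly_val (gs i))"
    have "(?s(0 := ?u)) 0 = ?u" by simp
    then obtain t s' where t: "exec p (?s(0 := ?u)) t s'" "t \<le> a * (S i + 1) ^ b" "s' 0 = Bit (Q i)"
      using p[OF i] unfolding runs_def by blast
    have "exec ?p ?s (1 + t) s'"
      by (rule exec_Assign_Seq, simp add: input_def encode_eq, simp) (rule t(1))
    moreover have "1 + t \<le> (1 + a) * (S i + 1) ^ b"
      using t(2) one_le_power[of "S i + 1" b] unfolding distrib_right by linarith
    then have "real (1 + t) \<le> real ((1 + a) * (S i + 1) ^ b)" by (rule of_nat_mono)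
    then have "real (1 + t) \<le> real (1 + a) * (real (S i) + 1) ^ b"
      by (simp only: of_nat_mult of_nat_power of_nat_add of_nat_1)
    ultimately show ?thesis unfolding answers_def using t(3) by blast
  qed
  then show ?thesis by blast
qed

theorem corollary3p9:
  fixes c :: real and P :: "real poly"
  assumes "c > 0"
  shows "\<exists>(algorithm :: com) (a :: nat) (b :: nat).
    \<forall>(F :: 'a::field poly) (G :: 'a poly) (G\<^sub>0 :: 'a poly) (G\<^sub>1 :: 'a poly) (G\<^sub>2 :: 'a poly)
      (m :: nat) (n :: nat) (T :: nat) (k :: nat) (l :: nat)
      (fs :: (nat \<times> 'a) list) (gs :: (nat \<times> 'a) list).
      n \<ge> 1
      \<and> pdeg F = ereal (real m + real n - 1) \<and> pdeg G = ereal (real m)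
      \<and> sparsity F \<le> T \<and> sparsity G \<le> T
      \<and> G = G\<^sub>0 + monom 1 k * G\<^sub>1 - monom 1 l * G\<^sub>2
      \<and> G\<^sub>1 \<noteq> 0
      \<and> ereal (real k) - pdeg G\<^sub>0 \<ge> ereal (c * real n)
      \<and> ereal (real l) - ereal (real k) - pdeg G\<^sub>1 \<ge> ereal (c * real n)
      \<and> pdeg G\<^sub>1 \<le> ereal (poly P (real T * log 2 (real (m + n))))
      \<and> sparse_rep fs F \<and> sparse_rep gs G
      \<longrightarrow> answers algorithm (input fs gs) (G dvd F)
            (real a * (1 + real T * log 2 (real (m + n))) ^ b)"
proof -
  define q where "q = nat \<lceil>1 / c\<rceil>"
  have "1 / c \<le> real q" unfolding q_def by linarith
  then have cq: "c * real q \<ge> 1" using assms by (simp add: field_simps)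
  then have q: "q \<ge> 1" by (cases q) auto
  obtain a\<^sub>P b\<^sub>P :: nat where P: "\<And>x. x \<ge> 0 \<Longrightarrow> poly P x \<le> real a\<^sub>P * (1 + x) ^ b\<^sub>P"
    using poly_le_power by blast
  define x where "x m n T = real T * log 2 (real (m + n))" for m n T :: nat
  define S where "S = (\<lambda>(fs :: (nat \<times> 'a) list, gs :: (nat \<times> 'a) list, m, n, T). nat \<lceil>x m n T\<rceil>)"
  \<comment> \<open>The width bound on the best pair stands in for the decomposition, since it is
    all that the cost estimate needs.\<close>
  define inst where "inst F G fs gs m n T \<longleftrightarrow> sparse_rep fs F \<and> sparse_rep gs G \<and> F \<noteq> 0 \<and> G \<noteq> 0 \<and>
      degree F = m + n - 1 \<and> degree G = m \<and> n \<ge> 1 \<and> sparsity F \<le> T \<and> sparsity G \<le> T \<and>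
      real (snd (best q n gs) - fst (best q n gs)) \<le> poly P (x m n T)"
    for F G :: "'a poly" and fs gs m n T
  define A where "A = {(fs, gs, m, n, T). \<exists>F G. inst F G fs gs m n T}"
  let ?fs = "\<lambda>i :: (nat \<times> 'a) list \<times> (nat \<times> 'a) list \<times> nat \<times> nat \<times> nat. fst i"
  let ?gs = "\<lambda>i :: (nat \<times> 'a) list \<times> (nat \<times> 'a) list \<times> nat \<times> nat \<times> nat. fst (snd i)"
  let ?U = "\<lambda>i. Cell (poly_val (?fs i)) (poly_val (?gs i))"
  have x_nonneg: "0 \<le> x m n T" if "n \<ge> 1" for m n T
    using that unfolding x_def by (intro mult_nonneg_nonneg) auto
  have T_pos: "T \<ge> 1" if "sparse_rep fs F" "F \<noteq> 0" "sparsity F \<le> T" for fs and F :: "'a poly" and T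
  proof -
    have "fs \<noteq> []" using sparse_rep_poly_of[OF that(1)] that(2) by auto
    then show ?thesis using sparse_rep_length[OF that(1)] that(3) by (cases fs) auto
  qed
  have size: "vsize (poly_val (?fs i)) \<le> 1 + (S i + 1) * (1 + (3 + (S i + 1)))"
    "vsize (poly_val (?gs i)) \<le> 1 + (S i + 1) * (1 + (3 + (S i + 1)))"
    "real (snd (best q (quot_len (?gs i) (?fs i)) (?gs i)) - fst (best q (quot_len (?gs i) (?fs i)) (?gs i)))
      \<le> real (a\<^sub>P * (1 + S i) ^ b\<^sub>P)" if i: "i \<in> A" for i
  proof -
    obtain fs gs m n T F G where i_eq: "i = (fs, gs, m, n, T)" and I: "inst F G fs gs m n T"
      using i unfolding A_def by blast
    have fs: "sparse_rep fs F" and gs: "sparse_rep gs G" and F: "F \<noteq> 0" "degree F = m + n - 1"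
      and G: "G \<noteq> 0" "degree G = m" and n: "n \<ge> 1" and T: "sparsity F \<le> T" "sparsity G \<le> T"
      and span: "real (snd (best q n gs) - fst (best q n gs)) \<le> poly P (x m n T)"
      using I unfolding inst_def by auto
    have xS: "x m n T \<le> real (S i)" unfolding S_def i_eq by simp linarith
    have T1: "T \<ge> 1" by (rule T_pos[OF fs F(1) T(1)])
    show "vsize (poly_val (?fs i)) \<le> 1 + (S i + 1) * (1 + (3 + (S i + 1)))"
      using vsize_input[OF fs _ T(1) T1 xS[unfolded x_def]] F n by (simp add: i_eq)
    show "vsize (poly_val (?gs i)) \<le> 1 + (S i + 1) * (1 + (3 + (S i + 1)))"
      using vsize_input[OF gs _ T(2) T1 xS[unfolded x_def]] G n by (simp add: i_eq)
    have len: "quot_len gs fs = n"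
      using n by (simp add: quot_len_def sparse_rep_ldeg[OF gs] sparse_rep_ldeg[OF fs] F G)
    have "real a\<^sub>P * (1 + x m n T) ^ b\<^sub>P \<le> real a\<^sub>P * (1 + real (S i)) ^ b\<^sub>P"
      using xS x_nonneg[OF n] by (intro mult_left_mono power_mono) auto
    with span P[OF x_nonneg[OF n, of m T]] show "real (snd (best q (quot_len (?gs i) (?fs i)) (?gs i)) -
        fst (best q (quot_len (?gs i) (?fs i)) (?gs i))) \<le> real (a\<^sub>P * (1 + S i) ^ b\<^sub>P)"
      unfolding i_eq fst_conv snd_conv len of_nat_mult of_nat_power of_nat_add of_nat_1 by linarith
  qed
  have bd: "pbd S A (\<lambda>i. 1 + (S i + 1) * (1 + (3 + (S i + 1))))"
    by (intro pbd_intros pbd_size)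
  have fs: "PT S A ?U (\<lambda>i. poly_val (?fs i))"
    by (rule PT_I[OF RT_left[OF RT_id] bd size(1)])
  have gs: "PT S A ?U (\<lambda>i. poly_val (?gs i))"
    by (rule PT_I[OF RT_right[OF RT_id] bd size(2)])
  have "pbd S A (\<lambda>i. a\<^sub>P * (1 + S i) ^ b\<^sub>P)"
    by (intro pbd_intros pbd_power pbd_size)
  then have "pbd S A (\<lambda>i. snd (best q (quot_len (?gs i) (?fs i)) (?gs i))
      - fst (best q (quot_len (?gs i) (?fs i)) (?gs i)))"
    by (rule pbd_mono) (use size(3) of_nat_le_iff in blast)
  from PT_answers[OF PT_decide_dvd[OF gs fs this]]
  obtain p a b where p: "\<And>i. i \<in> A \<Longrightarrow> answers p (input (?fs i) (?gs i)) (decide_dvd q (?gs i) (?fs i))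
      (real a * (real (S i) + 1) ^ b)" by blast
  have "answers p (input fs gs) (G dvd F) (real (a * 2 ^ b) * (1 + real T * log 2 (real (m + n))) ^ b)"
    if n: "n \<ge> 1" and deg: "pdeg F = ereal (real m + real n - 1)" "pdeg G = ereal (real m)"
      and T: "sparsity F \<le> T" "sparsity G \<le> T"
      and G: "G = G\<^sub>0 + monom 1 k * G\<^sub>1 - monom 1 l * G\<^sub>2" "G\<^sub>1 \<noteq> 0"
      and gaps: "ereal (real k) - pdeg G\<^sub>0 \<ge> ereal (c * real n)"
        "ereal (real l) - ereal (real k) - pdeg G\<^sub>1 \<ge> ereal (c * real n)"
      and small: "pdeg G\<^sub>1 \<le> ereal (poly P (real T * log 2 (real (m + n))))"
      and rep: "sparse_rep fs F" "sparse_rep gs G"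
    for F G G\<^sub>0 G\<^sub>1 G\<^sub>2 :: "'a poly" and m n T k l :: nat and fs gs
  proof -
    have F: "F \<noteq> 0" "degree F = m + n - 1" and G': "G \<noteq> 0" "degree G = m"
      using deg n unfolding pdeg_eq_iff by auto
    have "real (degree G\<^sub>1) \<le> poly P (x m n T)" using small G(2) by (simp add: pdeg_def x_def)
    then have "real (snd (best q n gs) - fst (best q n gs)) \<le> poly P (x m n T)"
      using span_bound[OF rep(2) G gaps assms cq n] by linarith
    then have "inst F G fs gs m n T"
      unfolding inst_def using rep F G' n T by simp
    then have "(fs, gs, m, n, T) \<in> A" unfolding A_def by blast
    from p[OF this] have *: "answers p (input fs gs) (G dvd F) (real a * (real (nat \<lceil>x m n T\<rceil>) + 1) ^ b)"
      using decide_dvd_correct[OF rep(2,1) G' F(2) n q] by (simp add: S_def)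
    \<comment> \<open>Rounding the size up to a natural number costs a factor 2, which reappears as
      \<open>2 ^ b\<close> in the constant.\<close>
    have "real (nat \<lceil>x m n T\<rceil>) + 1 \<le> 2 * (1 + x m n T)"
      using x_nonneg[OF n, of m T] ceiling_correct[of "x m n T"] by simp
    then have "(real (nat \<lceil>x m n T\<rceil>) + 1) ^ b \<le> (2 * (1 + x m n T)) ^ b"
      by (intro power_mono) auto
    then have "real a * (real (nat \<lceil>x m n T\<rceil>) + 1) ^ b \<le> real a * (2 * (1 + x m n T)) ^ b"
      by (intro mult_left_mono) auto
    also have "\<dots> = real (a * 2 ^ b) * (1 + real T * log 2 (real (m + n))) ^ b"
      unfolding power_mult_distrib x_def by simp
    finally show ?thesis using * unfolding answers_def by (meson order_trans)
  qed
  then show ?thesis by (intro exI[of _ p] exI[of _ "a * 2 ^ b"] exI[of _ b]) blast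
qed

end
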